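(* Let $n$ be a positive integer and let $\mathrm{Cov}(\boldsymbol{S}_n)$ be the set of covering relations of the strong Bruhat order $\boldsymbol{S}_n$ on the symmetric group $S_n$. Let $\mathrm{wt}:\mathrm{Cov}(\boldsymbol{S}_n)\to\mathbb{Z}[\alpha_1,\ldots,\alpha_{n-1},z]$ be defined, for a covering relation $v\lessdot vt_{ij}$ with $i<j$, by $$\mathrm{wt}(v\lessdot vt_{ij})=\alpha_i+\alpha_{i+1}+\cdots+\alpha_{j-1}+(b_{v\lessdot vt_{ij}}-d_{v\lessdot vt_{ij}})z .$$ Then $$m_{\mathrm{wt}}(e,w_0)=\binom{n}{2}!\cdot\prod_{1\le k<\ell\le n}\frac{\alpha_k+\cdots+\alpha_{\ell-1}}{\ell-k}.$$ In particular, $m_{\mathrm{wt}}(e,w_0)$ does not depend on $z$.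
   Context: Permutations $v\in S_n$ are written in one-line notation $v=v_1v_2\cdots v_n$ with $v_i=v(i)$; $e$ is the identity and $w_0=n\,(n-1)\cdots 2\,1$. $t_{ij}=(i\;j)$ is a transposition, so $vt_{ij}$ is obtained from $v$ by exchanging the entries in positions $i$ and $j$. $\ell(w)$ is the Coxeter length. The strong Bruhat order $\boldsymbol{S}_n$ is the partial order on $S_n$ with covering relations $v\lessdot w$ whenever $w=vt_{ij}$ for some $i<j$ and $\ell(w)=\ell(v)+1$. For a covering relation $v\lessdot w=vt_{ij}$ with $i<j$, define $b_{v\lessdot w}=\#\{i<k<j : v_k>v_j\}$ and $d_{v\lessdot w}=\#\{i<k<j : v_k<v_i\}$. Given a ring $R$ and a weight function $\mathrm{wt}:\mathrm{Cov}(\boldsymbol{S}_n)\to R$, the weight of a saturated chain $c=(u_1\lessdot u_2\lessdot\cdots\lessdot u_k)$ is $\mathrm{wt}(c)=\prod_{i=1}^{k-1}\mathrm{wt}(u_i\lessdot u_{i+1})$ (an empty product is $1$). For $v\le w$, $m_{\mathrm{wt}}(v,w)=\sum_{c}\mathrm{wt}(c)$, the sum over all saturated chains $c$ from $v$ to $w$. The identity is in $\mathbb{Q}[\alpha_1,\ldots,\alpha_{n-1},z]$, where $\alpha_1,\ldots,\alpha_{n-1},z$ are indeterminates. *)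

theory Defs
  imports
    Complex_Main
    "HOL-Combinatorics.Transposition"
    "HOL-Combinatorics.Permutations"
    "HOL-Library.Poly_Mapping"
begin

section \<open>The strong Bruhat order on $S_n$\<close>

text \<open>
  Elements of $S_n$ are functions \<^prop>\<open>v permutes {1..n}\<close>. In one-line notation the entry in
  position \<open>i\<close> is \<open>v i\<close>, and $v t_{ij}$ is \<^term>\<open>v \<circ> transpose i j\<close>.
\<close>

definition w0 :: "nat \<Rightarrow> nat \<Rightarrow> nat" where
  "w0 n = (\<lambda>i. if i \<in> {1..n} then n + 1 - i else i)"

text \<open>
  Coxeter length: the least number of factors in an expression of \<open>v\<close> as a product of the
  simple transpositions $(i\;\,i{+}1)$ with $1 \le i < n$.
\<close>

definition simple_product :: "nat list \<Rightarrow> nat \<Rightarrow> nat" where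
  "simple_product js = foldr (\<circ>) (map (\<lambda>i. transpose i (Suc i)) js) id"

definition coxeter_length :: "nat \<Rightarrow> (nat \<Rightarrow> nat) \<Rightarrow> nat" where
  "coxeter_length n v =
     (LEAST k. \<exists>js. length js = k \<and> set js \<subseteq> {1..<n} \<and> v = simple_product js)"

definition bruhat_cover :: "nat \<Rightarrow> (nat \<Rightarrow> nat) \<Rightarrow> (nat \<Rightarrow> nat) \<Rightarrow> bool" where
  "bruhat_cover n v w \<longleftrightarrow>
     v permutes {1..n} \<and>
     (\<exists>i j. 1 \<le> i \<and> i < j \<and> j \<le> n \<and> w = v \<circ> transpose i j) \<and>
     coxeter_length n w = coxeter_length n v + 1"

definition saturated_chains ::
    "nat \<Rightarrow> (nat \<Rightarrow> nat) \<Rightarrow> (nat \<Rightarrow> nat) \<Rightarrow> (nat \<Rightarrow> nat) list set" where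
  "saturated_chains n v w =
     {c. c \<noteq> [] \<and> set c \<subseteq> {u. u permutes {1..n}} \<and> hd c = v \<and> last c = w \<and>
         successively (bruhat_cover n) c}"

text \<open>
  A weight function is defined on all pairs of permutations, but only its values on covering
  relations are used below. The set of saturated chains is finite, since the length increases
  strictly along a chain.
\<close>

definition chain_weight ::
    "((nat \<Rightarrow> nat) \<Rightarrow> (nat \<Rightarrow> nat) \<Rightarrow> 'r::comm_ring_1) \<Rightarrow> (nat \<Rightarrow> nat) list \<Rightarrow> 'r" where
  "chain_weight wt c = (\<Prod>i<length c - 1. wt (c ! i) (c ! Suc i))"

definition weighted_chain_sum ::
    "nat \<Rightarrow> ((nat \<Rightarrow> nat) \<Rightarrow> (nat \<Rightarrow> nat) \<Rightarrow> 'r::comm_ring_1) \<Rightarrow>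
     (nat \<Rightarrow> nat) \<Rightarrow> (nat \<Rightarrow> nat) \<Rightarrow> 'r" where
  "weighted_chain_sum n wt v w = (\<Sum>c\<in>saturated_chains n v w. chain_weight wt c)"

section \<open>Multivariate polynomials\<close>

text \<open>
  Polynomials over \<open>'a\<close> are finitely supported maps from monomials to coefficients, and
  monomials are finitely supported maps from indeterminates to exponents. The indeterminates are
  indexed by \<^typ>\<open>nat\<close>: index \<open>0\<close> is $z$ and index $i \ge 1$ is $\alpha_i$. The ring
  $R[\alpha_1,\ldots,\alpha_{n-1},z]$ is the subring in which only the indices below \<open>n\<close> occur.
\<close>

type_synonym 'a mpolynomial = "(nat \<Rightarrow>\<^sub>0 nat) \<Rightarrow>\<^sub>0 'a"

definition Var :: "nat \<Rightarrow> 'a::comm_ring_1 mpolynomial" where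
  "Var x = Poly_Mapping.single (Poly_Mapping.single x 1) 1"

definition Const :: "'a::comm_ring_1 \<Rightarrow> 'a mpolynomial" where
  "Const a = Poly_Mapping.single 0 a"

abbreviation z_index :: nat where
  "z_index \<equiv> 0"

abbreviation z_var :: "'a::comm_ring_1 mpolynomial" where
  "z_var \<equiv> Var z_index"

abbreviation alpha_var :: "nat \<Rightarrow> 'a::comm_ring_1 mpolynomial" where
  "alpha_var i \<equiv> Var i"

definition occurs_in :: "nat \<Rightarrow> 'a::comm_ring_1 mpolynomial \<Rightarrow> bool" where
  "occurs_in x p \<longleftrightarrow> (\<exists>m\<in>Poly_Mapping.keys p. Poly_Mapping.lookup m x \<noteq> 0)"

text \<open>The inclusion of the integer polynomials into the rational polynomials.\<close>

definition rat_mpolynomial :: "int mpolynomial \<Rightarrow> rat mpolynomial" where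
  "rat_mpolynomial = Poly_Mapping.map rat_of_int"

section \<open>The weight function\<close>

text \<open>
  The positions $i<j$ with $w = v t_{ij}$; they are determined by \<open>v\<close> and \<open>w\<close> (see below).
\<close>

definition swap_positions :: "(nat \<Rightarrow> nat) \<Rightarrow> (nat \<Rightarrow> nat) \<Rightarrow> nat \<times> nat" where
  "swap_positions v w = (THE (i, j). i < j \<and> w = v \<circ> transpose i j)"

definition cover_b :: "(nat \<Rightarrow> nat) \<Rightarrow> (nat \<Rightarrow> nat) \<Rightarrow> nat" where
  "cover_b v w = (let (i, j) = swap_positions v w in card {k. i < k \<and> k < j \<and> v k > v j})"

definition cover_d :: "(nat \<Rightarrow> nat) \<Rightarrow> (nat \<Rightarrow> nat) \<Rightarrow> nat" where
  "cover_d v w = (let (i, j) = swap_positions v w in card {k. i < k \<and> k < j \<and> v k < v i})"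

definition bruhat_weight :: "(nat \<Rightarrow> nat) \<Rightarrow> (nat \<Rightarrow> nat) \<Rightarrow> int mpolynomial" where
  "bruhat_weight v w =
     (let (i, j) = swap_positions v w
      in (\<Sum>k\<in>{i..<j}. alpha_var k) + Const (int (cover_b v w) - int (cover_d v w)) * z_var)"

lemma swap_positions_eq:
  assumes "inj v" and "i < j"
  shows "swap_positions v (v \<circ> transpose i j) = (i, j)"
  unfolding swap_positions_def
proof (rule the_equality)
  show "case (i, j) of (i', j') \<Rightarrow> i' < j' \<and> v \<circ> transpose i j = v \<circ> transpose i' j'"
    using assms by simp
next
  fix p :: "nat \<times> nat"
  assume "case p of (i', j') \<Rightarrow> i' < j' \<and> v \<circ> transpose i j = v \<circ> transpose i' j'"
  then obtain i' j' where p: "p = (i', j')" "i' < j'"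
    and eq: "v \<circ> transpose i j = v \<circ> transpose i' j'"
    by (cases p) auto
  have tr: "transpose i j k = transpose i' j' k" for k
    using fun_cong[OF eq, of k] \<open>inj v\<close> by (simp add: inj_eq)
  from tr[of i] tr[of j] p \<open>i < j\<close> show "p = (i, j)"
    by (auto simp: transpose_def split: if_splits)
qed

lemma bruhat_weight_eq:
  assumes "v permutes {1..n}" and "i < j"
  shows "bruhat_weight v (v \<circ> transpose i j) =
    (\<Sum>k\<in>{i..<j}. alpha_var k) +
    Const (int (card {k. i < k \<and> k < j \<and> v k > v j}) -
           int (card {k. i < k \<and> k < j \<and> v k < v i})) * z_var"
  using swap_positions_eq[OF permutes_inj[OF assms(1)] assms(2)]
  by (simp add: bruhat_weight_def cover_b_def cover_d_def)

end

(*
  Monk's rule on the coinvariant algebra, with z switched on. Let E = sum_i x_i^2 d/dx_i, a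
  derivation that commutes with permutations of the variables. For L = sum_i beta_i x_i, where
  beta_i - beta_j = alpha_i + ... + alpha_(j-1), the divided differences satisfy
    d_m (L - z E) = (L' - z E) d_m + (beta_m - beta_(m+1))
  with L' obtained from L by a twist of its coefficients. The weighted sums over covers in the
  strong order obey the same recursion, so m_wt(e, w0) is the value of the top divided difference
  on (L - z E)^N 1, N = binom(n, 2), and (L - z E)^N 1 / N! is the coefficient of t^N in
  prod_i (1 + z t x_i)^(beta_i / z). Antisymmetrising that coefficient gives a determinant of
  Newton polynomials of the beta_i with nodes 0, z, 2z, ..., and the nodes do not affect it.

  The operators act on functions of a permutation u, with "x_i" taking the value x (u i); the
  x_j are elements of a differential field with x_j' = x_j^2, so that E becomes the pointwise
  derivation. Such a field is Q(alpha, z)((s)), with x_j = 1 / (j - s).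
*)
theory Submission
  imports Defs "HOL-Computational_Algebra.Formal_Laurent_Series"
    "HOL-Computational_Algebra.Polynomial_Factorial"
begin

section \<open>Covering relations below a permutation with an ascent\<close>

text \<open>The difference b - d is what closes the recursion. For divided differences, d_m E = E
  d_m + (x_m + x_(m+1)) d_m, because E (x_m - x_(m+1)) = (x_m - x_(m+1)) (x_m + x_(m+1)). For
  chains, conjugating a cover by the simple transposition at m changes b - d by exactly one when one
  end of the exchange is at m or m+1. Both effects are the same shift of two coefficients of L by z.
  Since L changes along the way, powers of a single operator are not stable under the recursion.
  Chain sums are therefore defined for a list that gives each step its own coefficient sequence, and
  only the last application takes all entries equal. The top divided difference is never composed
  from simple ones. Antisymmetrisation replaces it: under the signed sum over permutations each d_m
  is self-adjoint, and it acts on monomials that run from the staircase monomial down to 1, each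
  step sending a monomial to a monomial. The price is a Vandermonde factor in the x_j. It is nonzero
  because the x_j are distinct, and it also factors out of the antisymmetrised coefficient, so it
  cancels.\<close>

abbreviation sw :: "nat \<Rightarrow> nat \<Rightarrow> nat" where
  "sw m \<equiv> transpose m (Suc m)"

text \<open>Covers are indexed from their upper element because the recursion removes the last step
  of a chain. The condition on the entries in between encodes a length drop of exactly one, as
  \<open>down_pairs_iff_inversions\<close> confirms.\<close>

definition down_pairs :: "nat \<Rightarrow> (nat \<Rightarrow> nat) \<Rightarrow> (nat \<times> nat) set" where
  "down_pairs n w = {(a, b). 1 \<le> a \<and> a < b \<and> b \<le> n \<and> w b < w a \<and>
     (\<forall>k. a < k \<longrightarrow> k < b \<longrightarrow> w k < w b \<or> w a < w k)}"

text \<open>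
  For \<open>(a, b) \<in> down_pairs n w\<close> and \<open>v = w \<circ> transpose a b\<close>, this is $b_{v\lessdot w}-d_{v\lessdot w}$:
  the entries of \<open>v\<close> at \<open>a\<close> and \<open>b\<close> are \<open>w b\<close> and \<open>w a\<close>.
\<close>

definition excess :: "(nat \<Rightarrow> nat) \<Rightarrow> nat \<Rightarrow> nat \<Rightarrow> int" where
  "excess w a b = (\<Sum>k\<in>{a<..<b}. of_bool (w a < w k) - of_bool (w k < w b))"

definition pair_weight :: "'k::comm_ring_1 \<Rightarrow> (nat \<Rightarrow> 'k) \<Rightarrow> (nat \<Rightarrow> nat) \<Rightarrow> nat \<Rightarrow> nat \<Rightarrow> 'k" where
  "pair_weight z \<beta> w a b = \<beta> a - \<beta> b + of_int (excess w a b) * z"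

text \<open>The coefficients of the linear form after a divided difference at \<open>m\<close> has
  moved past it. The exchange is that of the variables; the two subtractions of \<open>z\<close>
  come from the commutator with E.\<close>

definition twist :: "'k::comm_ring_1 \<Rightarrow> nat \<Rightarrow> (nat \<Rightarrow> 'k) \<Rightarrow> nat \<Rightarrow> 'k" where
  "twist z m \<beta> = (\<lambda>i. \<beta> (sw m i) - (if i = m \<or> i = Suc m then z else 0))"

lemma finite_down_pairs [simp]: "finite (down_pairs n w)"
  by (rule finite_subset[of _ "{1..n} \<times> {1..n}"]) (auto simp: down_pairs_def)

lemma sw_less_sw:
  assumes "a < b" "(a, b) \<noteq> (m, Suc m)"
  shows "sw m a < sw m b"
  using assms by (auto simp: transpose_def)

lemma all_sw: "(\<forall>k. P k) \<longleftrightarrow> (\<forall>k. P (sw m k))"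
  by (metis transpose_involutory)

text \<open>Conjugation by \<open>sw m\<close> changes the positions between \<open>a\<close> and
  \<open>b\<close> only if one end is \<open>m\<close> or \<open>Suc m\<close>. For
  \<open>a = m\<close> or \<open>b = Suc m\<close> a position is lost, and by the ascent of
  \<open>w\<close> its entry never obstructed the cover. For \<open>a = Suc m\<close> or
  \<open>b = m\<close> one is gained, and that it does not obstruct is precisely the ascent
  condition on the lower permutation.\<close>

lemma swap_in_down_pairs_iff:
  assumes m: "1 \<le> m" "m < n" "w m < w (Suc m)"
    and ab: "a < b" "(a, b) \<noteq> (m, Suc m)"
  shows "(sw m a, sw m b) \<in> down_pairs n (w \<circ> sw m) \<longleftrightarrow>
    (a, b) \<in> down_pairs n w \<and> (w \<circ> transpose a b) m < (w \<circ> transpose a b) (Suc m)"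
proof -
  have L: "(sw m a, sw m b) \<in> down_pairs n (w \<circ> sw m) \<longleftrightarrow>
     1 \<le> sw m a \<and> sw m b \<le> n \<and> w b < w a \<and>
     (\<forall>k. sw m a < sw m k \<longrightarrow> sw m k < sw m b \<longrightarrow> w k < w b \<or> w a < w k)"
  proof -
    have "(\<forall>k. sw m a < k \<longrightarrow> k < sw m b \<longrightarrow> w (sw m k) < w b \<or> w a < w (sw m k)) \<longleftrightarrow>
        (\<forall>k. sw m a < sw m k \<longrightarrow> sw m k < sw m b \<longrightarrow> w k < w b \<or> w a < w k)"
      by (subst all_sw[of _ m]) simp
    then show ?thesis
      using sw_less_sw[OF ab] by (simp add: down_pairs_def)
  qed
  have bounds: "1 \<le> sw m a \<longleftrightarrow> 1 \<le> a" "sw m b \<le> n \<longleftrightarrow> b \<le> n"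
    using m ab by (auto simp: transpose_def)
  consider "a = m" "b > Suc m" | "a = Suc m" | "b = m" | "b = Suc m" "a < m"
    | "a \<noteq> m" "a \<noteq> Suc m" "b \<noteq> m" "b \<noteq> Suc m"
    using ab by force
  then show ?thesis
  proof cases
    case 1
    have "(\<forall>k. sw m a < sw m k \<longrightarrow> sw m k < sw m b \<longrightarrow> w k < w b \<or> w a < w k) \<longleftrightarrow>
      (\<forall>k. a < k \<longrightarrow> k < b \<longrightarrow> w k < w b \<or> w a < w k)"
    proof -
      have "(sw m a < sw m k \<longrightarrow> sw m k < sw m b \<longrightarrow> w k < w b \<or> w a < w k) \<longleftrightarrow>
        (a < k \<longrightarrow> k < b \<longrightarrow> w k < w b \<or> w a < w k)" for k
        using 1 m by (cases "k = Suc m \<or> k = m") (auto simp: transpose_def)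
      then show ?thesis by blast
    qed
    then show ?thesis
      using 1 m unfolding L bounds by (auto simp: down_pairs_def)
  next
    case 2
    have "(\<forall>k. sw m a < sw m k \<longrightarrow> sw m k < sw m b \<longrightarrow> w k < w b \<or> w a < w k) \<longleftrightarrow>
      (\<forall>k. a < k \<longrightarrow> k < b \<longrightarrow> w k < w b \<or> w a < w k) \<and> (w m < w b \<or> w a < w m)"
    proof -
      have "sw m a < sw m k \<and> sw m k < sw m b \<longleftrightarrow> a < k \<and> k < b \<or> k = m" for k
        using 2 ab by (cases "k = m \<or> k = Suc m") (auto simp: transpose_def)
      then show ?thesis by blast
    qed
    then show ?thesis
      using 2 m ab unfolding L bounds by (auto simp: down_pairs_def)
  next
    case 3
    have "(\<forall>k. sw m a < sw m k \<longrightarrow> sw m k < sw m b \<longrightarrow> w k < w b \<or> w a < w k) \<longleftrightarrow>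
      (\<forall>k. a < k \<longrightarrow> k < b \<longrightarrow> w k < w b \<or> w a < w k) \<and> (w (Suc m) < w b \<or> w a < w (Suc m))"
    proof -
      have "sw m a < sw m k \<and> sw m k < sw m b \<longleftrightarrow> a < k \<and> k < b \<or> k = Suc m" for k
        using 3 ab by (cases "k = m \<or> k = Suc m") (auto simp: transpose_def)
      then show ?thesis by blast
    qed
    then show ?thesis
      using 3 m ab unfolding L bounds by (auto simp: down_pairs_def)
  next
    case 4
    have "(\<forall>k. sw m a < sw m k \<longrightarrow> sw m k < sw m b \<longrightarrow> w k < w b \<or> w a < w k) \<longleftrightarrow>
      (\<forall>k. a < k \<longrightarrow> k < b \<longrightarrow> w k < w b \<or> w a < w k)"
    proof -
      have "(sw m a < sw m k \<longrightarrow> sw m k < sw m b \<longrightarrow> w k < w b \<or> w a < w k) \<longleftrightarrow>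
        (a < k \<longrightarrow> k < b \<longrightarrow> w k < w b \<or> w a < w k)" for k
        using 4 m by (cases "k = Suc m \<or> k = m") (auto simp: transpose_def)
      then show ?thesis by blast
    qed
    then show ?thesis
      using 4 m unfolding L bounds by (auto simp: down_pairs_def)
  next
    case 5
    have "(\<forall>k. sw m a < sw m k \<longrightarrow> sw m k < sw m b \<longrightarrow> w k < w b \<or> w a < w k) \<longleftrightarrow>
      (\<forall>k. a < k \<longrightarrow> k < b \<longrightarrow> w k < w b \<or> w a < w k)"
    proof -
      have "sw m a < sw m k \<and> sw m k < sw m b \<longleftrightarrow> a < k \<and> k < b" for k
        using 5 by (auto simp: transpose_def)
      then show ?thesis by blast
    qed
    then show ?thesis
      using 5 m ab unfolding L bounds by (auto simp: down_pairs_def transpose_def)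
  qed
qed

text \<open>The position lost or gained carries an entry above \<open>w a\<close> or below
  \<open>w b\<close>, so it moves the count by exactly one. Losing an entry above and gaining one
  below both lower it (\<open>a\<close> at \<open>m\<close> or \<open>Suc m\<close>); the other two
  cases raise it. This is the \<open>z\<close> in \<open>twist\<close>.\<close>

lemma excess_swap:
  assumes m: "w m < w (Suc m)"
    and ab: "(a, b) \<in> down_pairs n w"
    and up: "(w \<circ> transpose a b) m < (w \<circ> transpose a b) (Suc m)"
  shows "excess (w \<circ> sw m) (sw m a) (sw m b) =
    excess w a b - of_bool (a = m \<or> a = Suc m) + of_bool (b = m \<or> b = Suc m)"
proof -
  have lt: "a < b" "w b < w a" using ab by (auto simp: down_pairs_def)
  have ne: "(a, b) \<noteq> (m, Suc m)" using lt m by auto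
  define f where "f u v k = (of_bool (u < w k) - of_bool (w k < v) :: int)" for u v k
  have E: "excess w a b = (\<Sum>k\<in>{a<..<b}. f (w a) (w b) k)"
    by (simp add: excess_def f_def)
  have E': "excess (w \<circ> sw m) (sw m a) (sw m b) =
      (\<Sum>k\<in>{sw m a<..<sw m b}. f (w a) (w b) (sw m k))"
    by (simp add: excess_def f_def)
  consider "a = m" "b > Suc m" | "a = Suc m" | "b = m" | "b = Suc m" "a < m"
    | "a \<noteq> m" "a \<noteq> Suc m" "b \<noteq> m" "b \<noteq> Suc m"
    using lt ne by force
  then show ?thesis
  proof cases
    case 1
    then have s: "{a<..<b} = insert (Suc m) {Suc m<..<b}" by auto
    have "(\<Sum>k\<in>{Suc m<..<b}. f (w a) (w b) (sw m k)) = (\<Sum>k\<in>{Suc m<..<b}. f (w a) (w b) k)"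
      by (intro sum.cong) (auto simp: transpose_def)
    then show ?thesis
      using 1 m lt unfolding E E' s by (simp add: f_def transpose_def)
  next
    case 2
    then have s: "{sw m a<..<sw m b} = insert (Suc m) {a<..<b}" using lt by (auto simp: transpose_def)
    have "(\<Sum>k\<in>{a<..<b}. f (w a) (w b) (sw m k)) = (\<Sum>k\<in>{a<..<b}. f (w a) (w b) k)"
      using 2 by (intro sum.cong) (auto simp: transpose_def)
    then show ?thesis
      using 2 m lt up unfolding E E' s by (simp add: f_def)
  next
    case 3
    then have s: "{sw m a<..<sw m b} = insert m {a<..<b}" using lt by (auto simp: transpose_def)
    have "(\<Sum>k\<in>{a<..<b}. f (w a) (w b) (sw m k)) = (\<Sum>k\<in>{a<..<b}. f (w a) (w b) k)"
      using 3 by (intro sum.cong) (auto simp: transpose_def)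
    then show ?thesis
      using 3 m lt up unfolding E E' s by (simp add: f_def)
  next
    case 4
    then have s: "{a<..<b} = insert m {a<..<m}" by auto
    have "(\<Sum>k\<in>{a<..<m}. f (w a) (w b) (sw m k)) = (\<Sum>k\<in>{a<..<m}. f (w a) (w b) k)"
      by (intro sum.cong) (auto simp: transpose_def)
    then show ?thesis
      using 4 m lt unfolding E E' s by (simp add: f_def)
  next
    case 5
    have "(\<Sum>k\<in>{sw m a<..<sw m b}. f (w a) (w b) (sw m k)) = (\<Sum>k\<in>{a<..<b}. f (w a) (w b) k)"
      using 5 by (intro sum.reindex_bij_witness[of _ "sw m" "sw m"]) (auto simp: transpose_def)
    then show ?thesis
      using 5 unfolding E E' by (simp add: f_def)
  qed
qed

lemma sw_comp_transpose: "sw m \<circ> transpose (sw m a) (sw m b) = transpose a b \<circ> sw m"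
  by (rule ext) (auto simp: transpose_def)

text \<open>The pair \<open>(m, Suc m)\<close> is a cover below \<open>w \<circ> sw m\<close> and
  gives the first summand. All other covers there are conjugates of covers below \<open>w\<close>
  whose lower element keeps the ascent at \<open>m\<close>, with weights related by
  \<open>twist\<close>.\<close>

lemma sum_down_pairs_ascent:
  fixes G :: "(nat \<Rightarrow> nat) \<Rightarrow> 'k::comm_ring_1"
  assumes m: "1 \<le> m" "m < n" "w m < w (Suc m)"
  shows "(\<Sum>(a, b)\<in>down_pairs n (w \<circ> sw m).
            pair_weight z \<beta> (w \<circ> sw m) a b * G (w \<circ> sw m \<circ> transpose a b)) =
    (\<beta> m - \<beta> (Suc m)) * G w +
    (\<Sum>(a, b)\<in>down_pairs n w. pair_weight z (twist z m \<beta>) w a b *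
       (if (w \<circ> transpose a b) m < (w \<circ> transpose a b) (Suc m)
        then G (w \<circ> transpose a b \<circ> sw m) else 0))"
proof -
  define h where "h = (\<lambda>(a, b). (sw m a, sw m b))"
  define up where "up = (\<lambda>(a, b). (w \<circ> transpose a b) m < (w \<circ> transpose a b) (Suc m))"
  let ?A = "{p \<in> down_pairs n w. up p}"
  have hh: "h (h p) = p" for p by (cases p) (simp add: h_def)
  have inj: "inj_on h ?A" by (rule inj_on_inverseI) (rule hh)
  have "down_pairs n (w \<circ> sw m) = insert (m, Suc m) (h ` ?A)"
  proof (intro set_eqI iffI)
    fix p assume p: "p \<in> down_pairs n (w \<circ> sw m)"
    show "p \<in> insert (m, Suc m) (h ` ?A)"
    proof (cases "p = (m, Suc m)")
      case False
      obtain a b where h: "h p = (a, b)" by fastforce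
      then have p': "p = (sw m a, sw m b)" using hh[of p] by (simp add: h_def)
      have "a < b" "(a, b) \<noteq> (m, Suc m)"
      proof -
        have "sw m a < sw m b" using p p' by (simp add: down_pairs_def)
        then show "a < b" "(a, b) \<noteq> (m, Suc m)" using False p'
          by (auto simp: transpose_def split: if_splits)
      qed
      from swap_in_down_pairs_iff[OF m this] p p'
      have "(a, b) \<in> ?A" by (simp add: up_def)
      moreover have "p = h (a, b)" using hh[of p] h by simp
      ultimately show ?thesis by (intro insertI2 image_eqI)
    qed simp
  next
    fix p assume "p \<in> insert (m, Suc m) (h ` ?A)"
    then show "p \<in> down_pairs n (w \<circ> sw m)"
    proof
      assume "p = (m, Suc m)"
      then show ?thesis using m by (simp add: down_pairs_def)
    next
      assume "p \<in> h ` ?A"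
      then obtain a b where p: "p = (sw m a, sw m b)" "(a, b) \<in> ?A" by (auto simp: h_def)
      have "a < b" "(a, b) \<noteq> (m, Suc m)" using p m by (auto simp: down_pairs_def)
      from swap_in_down_pairs_iff[OF m this] p show ?thesis by (simp add: up_def)
    qed
  qed
  moreover have "(m, Suc m) \<notin> h ` ?A"
  proof
    assume "(m, Suc m) \<in> h ` ?A"
    then obtain p where "p \<in> down_pairs n w" "h p = (m, Suc m)" by force
    then have "p = (Suc m, m)" using hh[of p] by (simp add: h_def)
    then show False using \<open>p \<in> down_pairs n w\<close> by (simp add: down_pairs_def)
  qed
  ultimately have "(\<Sum>(a, b)\<in>down_pairs n (w \<circ> sw m).
            pair_weight z \<beta> (w \<circ> sw m) a b * G (w \<circ> sw m \<circ> transpose a b)) =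
      pair_weight z \<beta> (w \<circ> sw m) m (Suc m) * G (w \<circ> sw m \<circ> sw m) +
      (\<Sum>(a, b)\<in>h ` ?A. pair_weight z \<beta> (w \<circ> sw m) a b * G (w \<circ> sw m \<circ> transpose a b))"
    by simp
  also have "pair_weight z \<beta> (w \<circ> sw m) m (Suc m) * G (w \<circ> sw m \<circ> sw m) = (\<beta> m - \<beta> (Suc m)) * G w"
  proof -
    have "{m<..<Suc m} = {}" by auto
    then show ?thesis by (simp add: pair_weight_def excess_def comp_assoc)
  qed
  also have "(\<Sum>(a, b)\<in>h ` ?A. pair_weight z \<beta> (w \<circ> sw m) a b * G (w \<circ> sw m \<circ> transpose a b)) =
      (\<Sum>(a, b)\<in>?A. pair_weight z \<beta> (w \<circ> sw m) (sw m a) (sw m b) *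
          G (w \<circ> sw m \<circ> transpose (sw m a) (sw m b)))"
    by (subst sum.reindex[OF inj]) (simp add: h_def case_prod_unfold)
  also have "\<dots> = (\<Sum>(a, b)\<in>?A. pair_weight z (twist z m \<beta>) w a b * G (w \<circ> transpose a b \<circ> sw m))"
  proof (intro sum.cong refl, clarify)
    fix a b assume ab: "(a, b) \<in> down_pairs n w" "up (a, b)"
    have ex: "excess (w \<circ> sw m) (sw m a) (sw m b) =
        excess w a b - of_bool (a = m \<or> a = Suc m) + of_bool (b = m \<or> b = Suc m)"
      using excess_swap[OF m(3) ab(1)] ab(2) by (simp add: up_def)
    have "pair_weight z \<beta> (w \<circ> sw m) (sw m a) (sw m b) = pair_weight z (twist z m \<beta>) w a b"
      unfolding pair_weight_def ex twist_def by (simp add: algebra_simps)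
    moreover have "w \<circ> sw m \<circ> transpose (sw m a) (sw m b) = w \<circ> transpose a b \<circ> sw m"
      by (simp only: comp_assoc sw_comp_transpose)
    ultimately show "pair_weight z \<beta> (w \<circ> sw m) (sw m a) (sw m b) *
          G (w \<circ> sw m \<circ> transpose (sw m a) (sw m b)) =
        pair_weight z (twist z m \<beta>) w a b * G (w \<circ> transpose a b \<circ> sw m)"
      by simp
  qed
  also have "\<dots> = (\<Sum>(a, b)\<in>down_pairs n w. pair_weight z (twist z m \<beta>) w a b *
       (if (w \<circ> transpose a b) m < (w \<circ> transpose a b) (Suc m)
        then G (w \<circ> transpose a b \<circ> sw m) else 0))"
    by (rule sum.mono_neutral_cong_left) (auto simp: up_def split: if_splits)
  finally show ?thesis .
qed

text \<open>If \<open>a = m\<close> or \<open>b = Suc m\<close>, the other of the two positions lies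
  strictly between, and the cover condition keeps its entry out of the range from \<open>w b\<close>
  to \<open>w a\<close>. If \<open>a = Suc m\<close> or \<open>b = m\<close>, the exchange only
  widens the descent.\<close>

lemma descent_preserved:
  assumes m: "w (Suc m) < w m"
    and ab: "(a, b) \<in> down_pairs n w" "(a, b) \<noteq> (m, Suc m)"
  shows "(w \<circ> transpose a b) (Suc m) < (w \<circ> transpose a b) m"
proof -
  have lt: "a < b" "w b < w a" using ab by (auto simp: down_pairs_def)
  have btw: "a < k \<Longrightarrow> k < b \<Longrightarrow> w k < w b \<or> w a < w k" for k
    using ab by (auto simp: down_pairs_def)
  consider "a = m" "b > Suc m" | "a = Suc m" | "b = m" | "b = Suc m" "a < m"
    | "a \<noteq> m" "a \<noteq> Suc m" "b \<noteq> m" "b \<noteq> Suc m"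
    using lt ab by force
  then show ?thesis
    using m lt btw[of m] btw[of "Suc m"]
    by cases (auto simp: transpose_def)
qed

section \<open>Divided differences and raising operators\<close>

text \<open>
  Moving a divided difference at \<open>m\<close> to the right through a product of operators $L-zE$ with
  coefficient sequences \<open>bs\<close> produces one summand for each factor that it absorbs.
\<close>

primrec expand :: "'k::comm_ring_1 \<Rightarrow> nat \<Rightarrow> (nat \<Rightarrow> 'k) list \<Rightarrow> ((nat \<Rightarrow> 'k) list \<Rightarrow> 'k) \<Rightarrow> 'k"
  where
    "expand z m [] \<Phi> = 0"
  | "expand z m (\<beta> # bs) \<Phi> =
       (\<beta> m - \<beta> (Suc m)) * \<Phi> bs + expand z m bs (\<lambda>l. \<Phi> (twist z m \<beta> # l))"

lemma expand_cong:
  assumes "\<And>\<beta>. P \<beta> \<Longrightarrow> P (twist z m \<beta>)" and "\<forall>\<beta>\<in>set bs. P \<beta>"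
    and "\<And>l. Suc (length l) = length bs \<Longrightarrow> \<forall>\<beta>\<in>set l. P \<beta> \<Longrightarrow> \<Phi> l = \<Psi> l"
  shows "expand z m bs \<Phi> = expand z m bs \<Psi>"
  using assms(2,3)
proof (induction bs arbitrary: \<Phi> \<Psi>)
  case (Cons \<beta> bs)
  have "expand z m bs (\<lambda>l. \<Phi> (twist z m \<beta> # l)) = expand z m bs (\<lambda>l. \<Psi> (twist z m \<beta> # l))"
    using Cons.prems assms(1) by (intro Cons.IH) auto
  then show ?case using Cons.prems by simp
qed simp

lemma expand_add: "expand z m bs (\<lambda>l. \<Phi> l + \<Psi> l) = expand z m bs \<Phi> + expand z m bs \<Psi>"
  by (induction bs arbitrary: \<Phi> \<Psi>) (simp_all add: algebra_simps)

lemma expand_scale: "expand z m bs (\<lambda>l. c * \<Phi> l) = c * expand z m bs \<Phi>"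
  by (induction bs arbitrary: \<Phi>) (simp_all add: algebra_simps)

lemma expand_zero: "expand z m bs (\<lambda>l. 0) = 0"
  by (induction bs) simp_all

lemma expand_sum: "expand z m bs (\<lambda>l. \<Sum>i\<in>I. \<Phi> i l) = (\<Sum>i\<in>I. expand z m bs (\<Phi> i))"
  by (induction I rule: infinite_finite_induct) (simp_all add: expand_zero expand_add)

text \<open>The head of the list weights the topmost cover. Only chains from \<open>id\<close> with
  exactly as many steps as the list has entries contribute. Distinct sequences per step are needed
  because \<open>expand\<close> twists only the factors before the absorbed one.\<close>

primrec chain_sum ::
    "'k::comm_ring_1 \<Rightarrow> nat \<Rightarrow> (nat \<Rightarrow> 'k) list \<Rightarrow> (nat \<Rightarrow> nat) \<Rightarrow> 'k" where
    "chain_sum z n [] w = of_bool (w = id)"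
  | "chain_sum z n (\<beta> # bs) w =
       (\<Sum>(a, b)\<in>down_pairs n w. pair_weight z \<beta> w a b * chain_sum z n bs (w \<circ> transpose a b))"

text \<open>The combinatorial counterpart of applying a divided difference. At an ascent it is
  \<open>sum_down_pairs_ascent\<close> combined with the induction hypothesis. At a descent every
  cover other than \<open>(m, Suc m)\<close> keeps the descent and drops out, and the twisted weight
  of that one is opposite to the absorbed coefficient, so the two cancel.\<close>

lemma expand_chain_sum:
  assumes "inj w" and m: "1 \<le> m" "m < n"
  shows "expand z m bs (\<lambda>l. chain_sum z n l w) =
    (if w m < w (Suc m) then chain_sum z n bs (w \<circ> sw m) else 0)"
  using assms(1)
proof (induction bs arbitrary: w)
  case Nil
  have "w \<circ> sw m \<noteq> id" if "w m < w (Suc m)"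
  proof
    assume "w \<circ> sw m = id"
    from fun_cong[OF this, of m] fun_cong[OF this, of "Suc m"] that show False by simp
  qed
  then show ?case by simp
next
  case (Cons \<beta> bs)
  have inj: "inj (w \<circ> transpose a b)" for a b
    using Cons.prems by (intro inj_compose) auto
  have E: "expand z m (\<beta> # bs) (\<lambda>l. chain_sum z n l w) = (\<beta> m - \<beta> (Suc m)) * chain_sum z n bs w +
    (\<Sum>(a, b)\<in>down_pairs n w. pair_weight z (twist z m \<beta>) w a b *
       (if (w \<circ> transpose a b) m < (w \<circ> transpose a b) (Suc m)
        then chain_sum z n bs (w \<circ> transpose a b \<circ> sw m) else 0))"
    by (simp only: expand.simps chain_sum.simps expand_sum expand_scale case_prod_unfold
        Cons.IH[OF inj])
  show ?case
  proof (cases "w m < w (Suc m)")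
    case True
    then show ?thesis
      unfolding E using sum_down_pairs_ascent[OF m True, of z \<beta> "chain_sum z n bs"]
      by simp
  next
    case False
    then have desc: "w (Suc m) < w m"
      using Cons.prems by (metis inj_eq n_not_Suc_n nat_neq_iff)
    have "{m<..<Suc m} = {}" by auto
    then have wt: "pair_weight z (twist z m \<beta>) w m (Suc m) = \<beta> (Suc m) - \<beta> m"
      by (simp add: pair_weight_def twist_def excess_def)
    have mem: "(m, Suc m) \<in> down_pairs n w" using desc m by (auto simp: down_pairs_def)
    have "(\<Sum>(a, b)\<in>down_pairs n w. pair_weight z (twist z m \<beta>) w a b *
       (if (w \<circ> transpose a b) m < (w \<circ> transpose a b) (Suc m)
        then chain_sum z n bs (w \<circ> transpose a b \<circ> sw m) else 0)) =
      (\<Sum>(a, b)\<in>{(m, Suc m)}. pair_weight z (twist z m \<beta>) w a b *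
       (if (w \<circ> transpose a b) m < (w \<circ> transpose a b) (Suc m)
        then chain_sum z n bs (w \<circ> transpose a b \<circ> sw m) else 0))"
      using mem descent_preserved[OF desc]
      by (intro sum.mono_neutral_right) (fastforce+)
    also have "\<dots> = (\<beta> (Suc m) - \<beta> m) * chain_sum z n bs w"
      using desc wt by (simp add: comp_assoc)
    finally show ?thesis unfolding E using False by (simp add: algebra_simps)
  qed
qed

section \<open>Divided differences and raising operators over a differential field\<close>

locale differential_points =
  fixes D :: "'k::field_char_0 \<Rightarrow> 'k" and x :: "nat \<Rightarrow> 'k" and z :: 'k and n :: nat
  assumes D_add: "D (a + b) = D a + D b"
    and D_mult: "D (a * b) = a * D b + D a * b"
    and D_x: "D (x i) = x i * x i"
    and inj_x: "inj x"
    and D_z: "D z = 0"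
begin

lemma D_0 [simp]: "D 0 = 0"
  using D_add[of 0 0] by simp

lemma D_1 [simp]: "D 1 = 0"
  using D_mult[of 1 1] by simp

lemma D_minus: "D (- a) = - D a"
  using D_add[of a "- a"] by (simp add: eq_neg_iff_add_eq_0 add.commute)

lemma D_diff: "D (a - b) = D a - D b"
  using D_add[of a "- b"] by (simp add: D_minus)

definition const_seq :: "(nat \<Rightarrow> 'k) \<Rightarrow> bool" where
  "const_seq \<beta> \<longleftrightarrow> (\<forall>i. D (\<beta> i) = 0)"

lemma const_seq_twist: "const_seq \<beta> \<Longrightarrow> const_seq (twist z m \<beta>)"
  by (auto simp: const_seq_def twist_def D_diff D_z)

definition raise :: "(nat \<Rightarrow> 'k) \<Rightarrow> ((nat \<Rightarrow> nat) \<Rightarrow> 'k) \<Rightarrow> (nat \<Rightarrow> nat) \<Rightarrow> 'k" where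
  "raise \<beta> F u = (\<Sum>i\<in>{1..n}. \<beta> i * x (u i)) * F u - z * D (F u)"

primrec raises :: "(nat \<Rightarrow> 'k) list \<Rightarrow> (nat \<Rightarrow> nat) \<Rightarrow> 'k" where
    "raises [] = (\<lambda>u. 1)"
  | "raises (\<beta> # bs) = raise \<beta> (raises bs)"

definition divdiff :: "nat \<Rightarrow> ((nat \<Rightarrow> nat) \<Rightarrow> 'k) \<Rightarrow> (nat \<Rightarrow> nat) \<Rightarrow> 'k" where
  "divdiff m F u = (F u - F (u \<circ> sw m)) / (x (u m) - x (u (Suc m)))"

lemma D_expand:
  assumes "\<forall>\<beta>\<in>set bs. const_seq \<beta>"
  shows "D (expand z m bs \<Phi>) = expand z m bs (\<lambda>l. D (\<Phi> l))"
  using assms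
  by (induction bs arbitrary: \<Phi>) (simp_all add: D_add D_mult D_diff const_seq_def)

lemma sum_split_adjacent:
  fixes f :: "nat \<Rightarrow> 'k"
  assumes "1 \<le> m" "m < n"
  shows "(\<Sum>i\<in>{1..n}. f i) = f m + f (Suc m) + (\<Sum>i\<in>{1..n} - {m, Suc m}. f i)"
  using assms by (subst sum.subset_diff[of "{m, Suc m}"]) (auto simp: add.commute)

lemma divdiff_raise:
  assumes u: "inj u" and m: "1 \<le> m" "m < n"
  shows "divdiff m (raise \<beta> F) u =
    raise (twist z m \<beta>) (divdiff m F) u + (\<beta> m - \<beta> (Suc m)) * F u"
proof -
  define X Y where "X = x (u m)" and "Y = x (u (Suc m))"
  have ne: "X - Y \<noteq> 0" using inj_x u by (simp add: X_def Y_def inj_eq)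
  define L where "L = (\<Sum>i\<in>{1..n}. \<beta> i * x (u i))"
  define R where "R = (\<Sum>i\<in>{1..n} - {m, Suc m}. \<beta> i * x (u i))"
  have L: "L = \<beta> m * X + \<beta> (Suc m) * Y + R"
    unfolding L_def R_def X_def Y_def using m by (rule sum_split_adjacent)
  have "(\<Sum>i\<in>{1..n} - {m, Suc m}. \<beta> i * x ((u \<circ> sw m) i)) = R"
    unfolding R_def by (intro sum.cong) auto
  then have Ls: "(\<Sum>i\<in>{1..n}. \<beta> i * x ((u \<circ> sw m) i)) = \<beta> m * Y + \<beta> (Suc m) * X + R"
    using sum_split_adjacent[OF m, of "\<lambda>i. \<beta> i * x ((u \<circ> sw m) i)"] by (simp add: X_def Y_def)
  have "(\<Sum>i\<in>{1..n} - {m, Suc m}. twist z m \<beta> i * x (u i)) = R"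
    unfolding R_def by (intro sum.cong) (auto simp: twist_def)
  then have Lt: "(\<Sum>i\<in>{1..n}. twist z m \<beta> i * x (u i)) = (\<beta> (Suc m) - z) * X + (\<beta> m - z) * Y + R"
    using sum_split_adjacent[OF m, of "\<lambda>i. twist z m \<beta> i * x (u i)"] by (simp add: X_def Y_def twist_def)
  define A B where "A = F u" and "B = F (u \<circ> sw m)"
  define G where "G = divdiff m F u"
  \<comment> \<open>Clearing the denominator before applying \<open>D\<close> leaves only the
    product rule; \<open>D_x\<close> turns \<open>D (X - Y)\<close> into
    \<open>X * X - Y * Y\<close>, again a multiple of \<open>X - Y\<close>.\<close>
  have AB: "A - B = (X - Y) * G" using ne by (simp add: G_def divdiff_def A_def B_def X_def Y_def)
  have "D A - D B = (X - Y) * D G + (X * X - Y * Y) * G"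
    using arg_cong[OF AB, of D] by (simp add: D_diff D_mult X_def Y_def D_x)
  then have DA: "D A = D B + (X - Y) * D G + (X * X - Y * Y) * G" by (simp add: algebra_simps)
  have A: "A = B + (X - Y) * G" using AB by (simp add: algebra_simps)
  have "raise \<beta> F u - raise \<beta> F (u \<circ> sw m) =
      (X - Y) * (raise (twist z m \<beta>) (divdiff m F) u + (\<beta> m - \<beta> (Suc m)) * F u)"
    unfolding raise_def Ls Lt L_def[symmetric] A_def[symmetric] B_def[symmetric] G_def[symmetric]
    unfolding L DA unfolding A by (simp add: algebra_simps)
  then show ?thesis
    using ne by (simp add: divdiff_def[of m "raise \<beta> F"] X_def Y_def)
qed

text \<open>A divided difference kills the constant 1, so it must be absorbed by one of the factors.
  The derivation passes through \<open>expand\<close> because the absorbed coefficients are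
  constants.\<close>

lemma divdiff_raises:
  assumes "\<forall>\<beta>\<in>set bs. const_seq \<beta>" and u: "inj u" and m: "1 \<le> m" "m < n"
  shows "divdiff m (raises bs) u = expand z m bs (\<lambda>l. raises l u)"
  using assms(1)
proof (induction bs)
  case Nil
  then show ?case by (simp add: divdiff_def)
next
  case (Cons \<beta> bs)
  have "divdiff m (raises (\<beta> # bs)) u =
      raise (twist z m \<beta>) (divdiff m (raises bs)) u + (\<beta> m - \<beta> (Suc m)) * raises bs u"
    using divdiff_raise[OF u m] by simp
  also have "raise (twist z m \<beta>) (divdiff m (raises bs)) u =
      expand z m bs (\<lambda>l. raise (twist z m \<beta>) (raises l) u)"
  proof -
    have "raise (twist z m \<beta>) (divdiff m (raises bs)) u =
        (\<Sum>i\<in>{1..n}. twist z m \<beta> i * x (u i)) * expand z m bs (\<lambda>l. raises l u) +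
        (- z) * expand z m bs (\<lambda>l. D (raises l u))"
      using Cons by (simp add: raise_def D_expand)
    also have "\<dots> = expand z m bs (\<lambda>l. (\<Sum>i\<in>{1..n}. twist z m \<beta> i * x (u i)) * raises l u +
        (- z) * D (raises l u))"
      unfolding expand_add expand_scale ..
    finally show ?thesis by (simp add: raise_def)
  qed
  finally show ?case by simp
qed

text \<open>The antisymmetrisation of the product of \<open>h\<close> and \<open>F\<close>, which is
  its top divided difference times the Vandermonde product. No reduced word of the longest element
  enters.\<close>

definition pairing :: "((nat \<Rightarrow> nat) \<Rightarrow> 'k) \<Rightarrow> ((nat \<Rightarrow> nat) \<Rightarrow> 'k) \<Rightarrow> 'k" where
  "pairing h F = (\<Sum>u | u permutes {1..n}. of_int (sign u) * h u * F u)"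

lemma sum_sw:
  assumes "1 \<le> m" "m < n"
  shows "(\<Sum>u | u permutes {1..n}. f (u \<circ> sw m)) = (\<Sum>u | u permutes {1..n}. f u)"
  using sum_permutations_compose_right[of "sw m" "{1..n}" f] assms
  by (simp add: permutes_swap_id)

lemma sign_sw:
  assumes "u permutes {1..n}"
  shows "sign (u \<circ> sw m) = - sign u"
  using assms permutation_permutes[of u]
  by (subst sign_compose) (auto simp: sign_swap_id permutation_swap_id)

text \<open>Replacing \<open>u\<close> by \<open>u \<circ> sw m\<close> changes the sign of both
  \<open>sign u\<close> and the denominator, so the exchange of variables can be moved from one
  argument to the other.\<close>

lemma pairing_divdiff:
  assumes m: "1 \<le> m" "m < n"
  shows "pairing (divdiff m h) F = pairing h (divdiff m F)"
proof -
  let ?\<delta> = "\<lambda>u. x (u m) - x (u (Suc m))"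
  have "(\<Sum>u | u permutes {1..n}. of_int (sign u) * h (u \<circ> sw m) * F u / ?\<delta> u) =
      (\<Sum>u | u permutes {1..n}. of_int (sign (u \<circ> sw m)) * h (u \<circ> sw m \<circ> sw m) * F (u \<circ> sw m) / ?\<delta> (u \<circ> sw m))"
    using sum_sw[OF m, of "\<lambda>u. of_int (sign u) * h (u \<circ> sw m) * F u / ?\<delta> u"] by simp
  also have "\<dots> = (\<Sum>u | u permutes {1..n}. of_int (sign u) * h u * F (u \<circ> sw m) / ?\<delta> u)"
  proof (intro sum.cong refl)
    fix u assume "u \<in> {u. u permutes {1..n}}"
    then have s: "sign (u \<circ> sw m) = - sign u" by (simp add: sign_sw)
    have d: "?\<delta> (u \<circ> sw m) = - ?\<delta> u" by simp
    show "of_int (sign (u \<circ> sw m)) * h (u \<circ> sw m \<circ> sw m) * F (u \<circ> sw m) / ?\<delta> (u \<circ> sw m) =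
        of_int (sign u) * h u * F (u \<circ> sw m) / ?\<delta> u"
      unfolding s d by (simp add: comp_assoc del: minus_diff_eq)
  qed
  finally show ?thesis
    by (simp add: pairing_def divdiff_def diff_divide_distrib algebra_simps sum_subtractf)
qed

end

section \<open>Pairing with code monomials\<close>

text \<open>For a permutation this is the Lehmer code of \<open>w0 n \<circ> w\<close>: later larger
  entries are counted, so \<open>id\<close> has the staircase and \<open>w0 n\<close> has
  zero.\<close>

definition code :: "nat \<Rightarrow> (nat \<Rightarrow> nat) \<Rightarrow> nat \<Rightarrow> nat" where
  "code n w i = card {j. i < j \<and> j \<le> n \<and> w i < w j}"

text \<open>The old entry of \<open>m\<close> moves to \<open>Suc m\<close> and no longer has
  \<open>w (Suc m)\<close> to its right; by \<open>c\<close> its new count equals the old one at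
  \<open>Suc m\<close>. Position \<open>m\<close> inherits the old count of \<open>Suc m\<close>,
  which is one less.\<close>

lemma code_sw:
  assumes m: "1 \<le> m" "m < n" "w m < w (Suc m)" and c: "code n w m = Suc (code n w (Suc m))"
  shows "code n (w \<circ> sw m) = (code n w)(m := code n w m - 1)"
proof
  fix i
  have fin: "finite {j. i < j \<and> j \<le> n \<and> Q j}" for i Q by simp
  consider "i = m" | "i = Suc m" | "i \<noteq> m" "i \<noteq> Suc m" by blast
  then show "code n (w \<circ> sw m) i = ((code n w)(m := code n w m - 1)) i"
  proof cases
    case 1
    have "{j. m < j \<and> j \<le> n \<and> (w \<circ> sw m) m < (w \<circ> sw m) j} =
      {j. Suc m < j \<and> j \<le> n \<and> w (Suc m) < w j}"
      using m by (auto simp: transpose_def Suc_lessI split: if_splits)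
    then show ?thesis using 1 c by (simp add: code_def)
  next
    case 2
    have "{j. Suc m < j \<and> j \<le> n \<and> (w \<circ> sw m) (Suc m) < (w \<circ> sw m) j} =
      {j. m < j \<and> j \<le> n \<and> w m < w j} - {Suc m}"
      using m by (auto simp: transpose_def split: if_splits)
    then have "code n (w \<circ> sw m) (Suc m) = code n w m - 1"
      using m by (simp add: code_def)
    then show ?thesis using 2 c by simp
  next
    case 3
    have "bij_betw (sw m) {j. i < j \<and> j \<le> n \<and> w i < w (sw m j)} {j. i < j \<and> j \<le> n \<and> w i < w j}"
      using 3 m by (intro bij_betw_byWitness[of _ "sw m"]) (auto simp: transpose_def split: if_splits)
    then show ?thesis using 3 bij_betw_same_card by (force simp: code_def)
  qed
qed

lemma sum_code_sw:
  assumes m: "1 \<le> m" "m < n" "w m < w (Suc m)" and c: "code n w m = Suc (code n w (Suc m))"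
  shows "(\<Sum>i\<in>{1..n}. code n w i) = Suc (\<Sum>i\<in>{1..n}. code n (w \<circ> sw m) i)"
proof -
  have "(\<Sum>i\<in>{1..n} - {m}. code n (w \<circ> sw m) i) = (\<Sum>i\<in>{1..n} - {m}. code n w i)"
    unfolding code_sw[OF assms] by (intro sum.cong) auto
  moreover have "code n w m = Suc (code n (w \<circ> sw m) m)"
    using c by (simp add: code_sw[OF assms])
  ultimately show ?thesis
    using m sum.remove[of "{1..n}" m "code n w"] sum.remove[of "{1..n}" m "code n (w \<circ> sw m)"]
    by simp
qed

lemma code_less_imp_less:
  assumes "inj w" and c: "code n w (Suc m) < code n w m"
  shows "w m < w (Suc m)"
proof (rule ccontr)
  assume "\<not> w m < w (Suc m)"
  then have "w (Suc m) < w m" using \<open>inj w\<close> by (metis inj_eq n_not_Suc_n nat_neq_iff)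
  then have "{j. m < j \<and> j \<le> n \<and> w m < w j} \<subseteq> {j. Suc m < j \<and> j \<le> n \<and> w (Suc m) < w j}"
    by (auto intro: Suc_lessI)
  then have "code n w m \<le> code n w (Suc m)"
    unfolding code_def by (intro card_mono) auto
  then show False using c by simp
qed

lemma w0_permutes: "w0 n permutes {1..n}"
  by (rule bij_imp_permutes, rule bij_betw_byWitness[of _ "w0 n"]) (auto simp: w0_def)

lemma code_zero_imp_w0:
  assumes w: "w permutes {1..n}" and c: "\<And>i. i \<in> {1..n} \<Longrightarrow> code n w i = 0"
  shows "w = w0 n"
proof -
  have dec: "w j < w i" if "1 \<le> i" "i < j" "j \<le> n" for i j
  proof -
    have "finite {j. i < j \<and> j \<le> n \<and> w i < w j}" by simp
    then have "\<not> w i < w j" using c[of i] that by (auto simp: code_def)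
    moreover have "w i \<noteq> w j" using permutes_inj[OF w] that by (simp add: inj_eq)
    ultimately show ?thesis by simp
  qed
  have ge: "i \<le> w (w0 n i)" if "1 \<le> i" "i \<le> n" for i
    using that
  proof (induction i rule: nat_induct_at_least)
    case base
    have "w0 n 1 \<in> {1..n}" using base by (auto simp: w0_def)
    then have "w (w0 n 1) \<in> {1..n}" using permutes_in_image[OF w] by blast
    then show ?case by simp
  next
    case (Suc i)
    have "w (w0 n i) < w (w0 n (Suc i))"
      using Suc.prems Suc.hyps by (intro dec) (auto simp: w0_def)
    then show ?case using Suc by simp
  qed
  have "w \<circ> w0 n = id"
    using ge by (intro permutes_natset_ge[OF permutes_compose[OF w0_permutes w]]) auto
  then have "w \<circ> w0 n \<circ> w0 n = w0 n" by simp
  moreover have "w0 n \<circ> w0 n = id" by (rule ext) (auto simp: w0_def)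
  ultimately show ?thesis by (simp add: comp_assoc)
qed

context differential_points begin

definition monomial :: "(nat \<Rightarrow> nat) \<Rightarrow> (nat \<Rightarrow> nat) \<Rightarrow> 'k" where
  "monomial a u = (\<Prod>i\<in>{1..n}. x (u i) ^ a i)"

text \<open>With exponents p + 1 and p on the two variables, the numerator is (X - Y) X^p Y^p times
  the rest. A larger gap between the exponents would produce several monomials.\<close>

lemma divdiff_monomial:
  assumes u: "inj u" and m: "1 \<le> m" "m < n" and a: "a m = Suc (a (Suc m))"
  shows "divdiff m (monomial a) u = monomial (a(m := a m - 1)) u"
proof -
  define X Y where "X = x (u m)" and "Y = x (u (Suc m))"
  define R where "R = (\<Prod>i\<in>{1..n} - {m, Suc m}. x (u i) ^ a i)"
  have two: "(\<Prod>i\<in>{1..n}. f i) = f m * f (Suc m) * (\<Prod>i\<in>{1..n} - {m, Suc m}. f i)"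
    for f :: "nat \<Rightarrow> 'k"
    using m by (subst prod.subset_diff[of "{m, Suc m}"]) (auto simp: mult.commute)
  have ne: "X - Y \<noteq> 0" using inj_x u by (simp add: X_def Y_def inj_eq)
  have "(\<Prod>i\<in>{1..n} - {m, Suc m}. x ((u \<circ> sw m) i) ^ a i) = R"
    unfolding R_def by (intro prod.cong) auto
  moreover have "(\<Prod>i\<in>{1..n} - {m, Suc m}. x (u i) ^ (a(m := a m - 1)) i) = R"
    unfolding R_def by (intro prod.cong) auto
  ultimately show ?thesis
    using ne a unfolding divdiff_def monomial_def two
    by (simp add: R_def X_def Y_def field_simps)
qed

abbreviation staircase :: nat where
  "staircase \<equiv> \<Sum>i\<in>{1..n}. n - i"

text \<open>
  Starting from the pairing with $x^{(n-1,\ldots,1,0)}$ and using that divided differences are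
  self-adjoint, the coefficient of \<open>w\<close> in the expansion of \<open>raises bs\<close> is read off by pairing
  with $x^{code(w)}$, as long as each step from \<open>w\<close> to \<open>w \<circ> sw m\<close> lowers the code by one in a
  single position.
\<close>

definition computes :: "(nat \<Rightarrow> nat) \<Rightarrow> bool" where
  "computes w \<longleftrightarrow> (\<forall>bs. (\<forall>\<beta>\<in>set bs. const_seq \<beta>) \<longrightarrow> length bs + (\<Sum>i\<in>{1..n}. code n w i) = staircase \<longrightarrow>
     pairing (monomial (code n w)) (raises bs) =
     pairing (monomial (\<lambda>i. n - i)) (\<lambda>u. 1) * chain_sum z n bs w)"

lemma code_id: "code n id i = n - i"
proof -
  have "{j. i < j \<and> j \<le> n \<and> id i < id j} = {i<..n}" by auto
  then show ?thesis by (simp add: code_def)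
qed

text \<open>The code of \<open>id\<close> already has total \<open>staircase\<close>, so the degree
  condition leaves only the empty list.\<close>

lemma computes_id: "computes id"
proof -
  have "code n id = (\<lambda>i. n - i)" by (simp add: fun_eq_iff code_id)
  then show ?thesis by (auto simp: computes_def)
qed

text \<open>The new monomial is a divided difference of the old one. Self-adjointness moves the
  divided difference onto \<open>raises bs\<close>, where it expands into lists shorter by one; the
  assumption on \<open>w\<close> evaluates these, and \<open>expand_chain_sum\<close> reassembles
  them.\<close>

lemma computes_sw:
  assumes w: "w permutes {1..n}" and m: "1 \<le> m" "m < n"
    and c: "code n w m = Suc (code n w (Suc m))" and comp: "computes w"
  shows "computes (w \<circ> sw m)"
  unfolding computes_def
proof (intro allI impI)
  fix bs
  assume bs: "\<forall>\<beta>\<in>set bs. const_seq \<beta>"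
    and len: "length bs + (\<Sum>i\<in>{1..n}. code n (w \<circ> sw m) i) = staircase"
  have inj: "inj w" using w by (rule permutes_inj)
  have asc: "w m < w (Suc m)" using c by (intro code_less_imp_less[OF inj, where n = n]) simp
  note cs = code_sw[OF m asc c]
  have len': "length l + (\<Sum>i\<in>{1..n}. code n w i) = staircase" if "Suc (length l) = length bs"
    for l :: "(nat \<Rightarrow> 'k) list"
    using len that sum_code_sw[OF m asc c] by simp
  let ?h = "monomial (code n w)"
  have "pairing (monomial (code n (w \<circ> sw m))) (raises bs) = pairing (divdiff m ?h) (raises bs)"
    unfolding pairing_def cs using divdiff_monomial[OF _ m] c
    by (intro sum.cong) (auto simp: permutes_inj)
  also have "\<dots> = pairing ?h (divdiff m (raises bs))"
    using m by (rule pairing_divdiff)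
  also have "\<dots> = (\<Sum>u | u permutes {1..n}. of_int (sign u) * ?h u * expand z m bs (\<lambda>l. raises l u))"
    unfolding pairing_def using divdiff_raises[OF bs _ m]
    by (intro sum.cong) (auto simp: permutes_inj)
  also have "\<dots> = expand z m bs (\<lambda>l. pairing ?h (raises l))"
    by (simp only: pairing_def expand_sum expand_scale)
  also have "\<dots> = expand z m bs (\<lambda>l. pairing (monomial (\<lambda>i. n - i)) (\<lambda>u. 1) * chain_sum z n l w)"
    using comp len' by (intro expand_cong[of const_seq]) (auto simp: const_seq_twist bs computes_def)
  also have "\<dots> = pairing (monomial (\<lambda>i. n - i)) (\<lambda>u. 1) * chain_sum z n bs (w \<circ> sw m)"
    using asc by (simp add: expand_scale expand_chain_sum[OF inj m])
  finally show "pairing (monomial (code n (w \<circ> sw m))) (raises bs) =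
      pairing (monomial (\<lambda>i. n - i)) (\<lambda>u. 1) * chain_sum z n bs (w \<circ> sw m)" .
qed

lemma computes_w0_if_balanced:
  assumes "w permutes {1..n}" and "computes w"
    and "\<And>i. 1 \<le> i \<Longrightarrow> i < n \<Longrightarrow>
      code n w i = code n w (Suc i) \<or> code n w i = Suc (code n w (Suc i))"
  shows "computes (w0 n)"
  using assms
proof (induction "\<Sum>i\<in>{1..n}. code n w i" arbitrary: w rule: less_induct)
  case less
  show ?case
  proof (cases "\<exists>i. 1 \<le> i \<and> i < n \<and> code n w i \<noteq> code n w (Suc i)")
    case False
    have "code n w i = 0" if "i \<in> {1..n}" for i
    proof -
      have "i \<le> n" "1 \<le> i" using that by auto
      then show ?thesis
      proof (induction rule: inc_induct)
        case base
        have "{j. n < j \<and> j \<le> n \<and> w n < w j} = {}" by auto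
        then show ?case by (simp add: code_def)
      next
        case (step i)
        then show ?case using False by simp
      qed
    qed
    then show ?thesis using code_zero_imp_w0 less.prems by metis
  next
    case True
    \<comment> \<open>At the leftmost drop the codes before \<open>m\<close> all equal that of
      \<open>m\<close>. Lowering the code at \<open>m\<close> opens a drop of one just before it and
      closes the one after it, so all drops stay 0 or 1.\<close>
    define m where "m = (LEAST i. 1 \<le> i \<and> i < n \<and> code n w i \<noteq> code n w (Suc i))"
    have m: "1 \<le> m" "m < n" "code n w m \<noteq> code n w (Suc m)"
      using LeastI_ex[OF True] by (simp_all add: m_def)
    have before: "code n w i = code n w (Suc i)" if "1 \<le> i" "i < m" for i
      using not_less_Least[OF that(2)[unfolded m_def]] that m by simp
    have c: "code n w m = Suc (code n w (Suc m))" using less.prems(3)[of m] m by simp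
    have inj: "inj w" using less.prems by (simp add: permutes_inj)
    have asc: "w m < w (Suc m)" using c by (intro code_less_imp_less[OF inj, where n = n]) simp
    note cs = code_sw[OF m(1,2) asc c]
    show ?thesis
    proof (rule less.hyps[of "w \<circ> sw m"])
      show "(\<Sum>i\<in>{1..n}. code n (w \<circ> sw m) i) < (\<Sum>i\<in>{1..n}. code n w i)"
        using sum_code_sw[OF m(1,2) asc c] by simp
      show "w \<circ> sw m permutes {1..n}"
        using m by (intro permutes_compose[OF _ less.prems(1)] permutes_swap_id) auto
      show "computes (w \<circ> sw m)"
        using computes_sw[OF less.prems(1) m(1,2) c less.prems(2)] .
      show "code n (w \<circ> sw m) i = code n (w \<circ> sw m) (Suc i) \<or>
          code n (w \<circ> sw m) i = Suc (code n (w \<circ> sw m) (Suc i))" if "1 \<le> i" "i < n" for i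
        unfolding cs using less.prems(3)[OF that] before[of i] c that by auto
    qed
  qed
qed

text \<open>At the end of the path from \<open>id\<close> to \<open>w0 n\<close> the monomial has
  become 1, and the pairing is the plain antisymmetrisation of the iterated operator.\<close>

lemma pairing_raises_w0:
  assumes "\<forall>\<beta>\<in>set bs. const_seq \<beta>" and "length bs = staircase"
  shows "pairing (\<lambda>u. 1) (raises bs) =
    pairing (monomial (\<lambda>i. n - i)) (\<lambda>u. 1) * chain_sum z n bs (w0 n)"
proof -
  have comp: "computes (w0 n)"
    by (rule computes_w0_if_balanced[OF permutes_id computes_id]) (auto simp: code_id)
  have "code n (w0 n) i = 0" if "i \<in> {1..n}" for i
  proof -
    have "{j. i < j \<and> j \<le> n \<and> w0 n i < w0 n j} = {}" using that by (auto simp: w0_def)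
    then show ?thesis unfolding code_def by (simp only: card.empty)
  qed
  then have "(\<Sum>i\<in>{1..n}. code n (w0 n) i) = 0" and "monomial (code n (w0 n)) = (\<lambda>u. 1)"
    by (simp_all add: monomial_def fun_eq_iff)
  then show ?thesis using comp assms unfolding computes_def by simp
qed

end

section \<open>Alternants and the generating function\<close>

definition alternant :: "nat \<Rightarrow> (nat \<Rightarrow> 'k::comm_ring_1) \<Rightarrow> (nat \<Rightarrow> nat) \<Rightarrow> 'k" where
  "alternant n y f = (\<Sum>u | u permutes {1..n}. of_int (sign u) * (\<Prod>i\<in>{1..n}. y (u i) ^ f i))"


lemma sign_comp_permutes:
  assumes "finite S" "p permutes S" "q permutes S"
  shows "sign (p \<circ> q) = sign p * sign q"
  using assms by (intro sign_compose permutes_imp_permutation[of S])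

lemma alternant_permute:
  assumes s: "s permutes {1..n}"
  shows "alternant n y (f \<circ> s) = of_int (sign s) * alternant n y f"
proof -
  have "alternant n y (f \<circ> s) =
      (\<Sum>u | u permutes {1..n}. of_int (sign (u \<circ> s)) * (\<Prod>i\<in>{1..n}. y ((u \<circ> s) i) ^ (f \<circ> s) i))"
    unfolding alternant_def by (rule sum_permutations_compose_right[OF s])
  also have "\<dots> = (\<Sum>u | u permutes {1..n}. of_int (sign s) * (of_int (sign u) * (\<Prod>i\<in>{1..n}. y (u i) ^ f i)))"
  proof (intro sum.cong refl)
    fix u assume "u \<in> {u. u permutes {1..n}}"
    then have "sign (u \<circ> s) = sign s * sign u"
      using s by (simp add: sign_comp_permutes[of "{1..n}"])
    moreover have "(\<Prod>i\<in>{1..n}. y ((u \<circ> s) i) ^ (f \<circ> s) i) = (\<Prod>i\<in>{1..n}. y (u i) ^ f i)"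
      using prod.permute[OF s, of "\<lambda>i. y (u i) ^ f i"] by (simp add: comp_def)
    ultimately show "of_int (sign (u \<circ> s)) * (\<Prod>i\<in>{1..n}. y ((u \<circ> s) i) ^ (f \<circ> s) i) =
        of_int (sign s) * (of_int (sign u) * (\<Prod>i\<in>{1..n}. y (u i) ^ f i))"
      by (simp add: mult.assoc)
  qed
  finally show ?thesis by (simp add: alternant_def sum_distrib_left)
qed

lemma alternant_eq_0:
  fixes y :: "nat \<Rightarrow> 'k::field_char_0"
  assumes "\<not> inj_on f {1..n}"
  shows "alternant n y f = 0"
proof -
  obtain i j where ij: "i \<in> {1..n}" "j \<in> {1..n}" "i \<noteq> j" "f i = f j"
    using assms by (auto simp: inj_on_def)
  have "f \<circ> transpose i j = f" using ij by (auto simp: transpose_def fun_eq_iff)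
  with alternant_permute[of "transpose i j" n y f] ij
  have "alternant n y f = - alternant n y f" by (simp add: permutes_swap_id sign_swap_id)
  then show ?thesis by simp
qed

text \<open>The maximum of c + 1 distinct naturals is at least c. Removing it leaves a set that
  satisfies the same bound, and the bound then forces the maximum to be c.\<close>

lemma set_eq_initial_segment:
  fixes A :: "nat set"
  assumes "finite A" "\<Sum>A \<le> \<Sum>{0..<card A}"
  shows "A = {0..<card A}"
  using assms
proof (induction "card A" arbitrary: A)
  case (Suc c)
  define M where "M = Max A"
  have ne: "A \<noteq> {}" using Suc.hyps by auto
  have M: "M \<in> A" using Suc.prems ne by (simp add: M_def)
  have "A \<subseteq> {0..M}" using Suc.prems by (auto simp: M_def)
  then have "card A \<le> Suc M" using card_mono[of "{0..M}" A] by simp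
  then have cM: "c \<le> M" using Suc.hyps by simp
  have c: "c = card (A - {M})" using Suc.hyps M by simp
  have sum: "\<Sum>A = M + \<Sum>(A - {M})" using Suc.prems M by (simp add: sum.remove)
  have le: "M + \<Sum>(A - {M}) \<le> \<Sum>{0..<c} + c"
    using Suc.prems(2) unfolding Suc.hyps(2)[symmetric] sum by simp
  then have A': "A - {M} = {0..<c}"
    using Suc.hyps(1)[OF c] Suc.prems cM c by simp
  then have "M = c" using le cM by simp
  moreover have "A = insert M {0..<c}" using A' M by blast
  ultimately show ?case
    by (simp add: Suc.hyps(2)[symmetric] atLeast0_lessThan_Suc)
qed simp

lemma sum_staircase: "(\<Sum>i\<in>{1..n}. n - i) = \<Sum>{0..<n::nat}"
  by (rule sum.reindex_bij_witness[of _ "\<lambda>k. n - k" "\<lambda>k. n - k"]) auto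

lemma inj_staircase_permutation:
  fixes f :: "nat \<Rightarrow> nat" and n :: nat
  assumes inj: "inj_on f {1..n}" and sum: "(\<Sum>i\<in>{1..n}. f i) = (\<Sum>i\<in>{1..n}. n - i)"
  obtains s where "s permutes {1..n}" "\<And>i. i \<in> {1..n} \<Longrightarrow> f i = n - s i"
proof -
  have card: "card (f ` {1..n}) = n" using inj by (simp add: card_image)
  have "\<Sum>(f ` {1..n}) = \<Sum>{0..<n}"
    using sum.reindex[OF inj, of "\<lambda>k. k"] sum sum_staircase[of n] by (simp only: comp_def)
  then have img: "f ` {1..n} = {0..<n}"
    using set_eq_initial_segment[of "f ` {1..n}"] card by simp
  define s where "s i = (if i \<in> {1..n} then n - f i else i)" for i
  have lt: "f i < n" if "i \<in> {1..n}" for i using img that by force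
  have "s permutes {1..n}"
  proof (rule bij_imp_permutes)
    have "inj_on s {1..n}"
    proof (rule inj_onI)
      fix i j assume "i \<in> {1..n}" "j \<in> {1..n}" "s i = s j"
      then have "f i = f j" using lt[of i] lt[of j] by (simp add: s_def)
      then show "i = j" using inj \<open>i \<in> {1..n}\<close> \<open>j \<in> {1..n}\<close> by (meson inj_onD)
    qed
    moreover have "s ` {1..n} \<subseteq> {1..n}"
    proof
      fix k assume "k \<in> s ` {1..n}"
      then obtain i where "i \<in> {1..n}" "k = n - f i" by (auto simp: s_def)
      then show "k \<in> {1..n}" using lt[of i] by simp
    qed
    ultimately show "bij_betw s {1..n} {1..n}"
      by (simp add: bij_betw_def endo_inj_surj)
  qed (auto simp: s_def)
  moreover have "f i = n - s i" if "i \<in> {1..n}" for i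
    using lt[OF that] that by (simp add: s_def)
  ultimately show thesis using that by blast
qed

text \<open>
  Exchanging the interpolation nodes does not change the determinant of the Newton basis
  polynomials, and for the nodes \<open>y n, y (n - 1), \<dots>\<close> the matrix is triangular.
\<close>

lemma newton_alternant:
  fixes y r :: "nat \<Rightarrow> 'k::field_char_0"
  shows "(\<Sum>u | u permutes {1..n}. of_int (sign u) * (\<Prod>i\<in>{1..n}. \<Prod>l<n - i. y (u i) - r l)) =
    (\<Prod>i\<in>{1..n}. \<Prod>j\<in>{i<..n}. y i - y j)"
proof -
  have leading: "(\<Sum>u | u permutes {1..n}. of_int (sign u) * (\<Prod>i\<in>{1..n}. \<Prod>l<n - i. y (u i) - r l)) =
      alternant n y (\<lambda>i. n - i)" for r :: "nat \<Rightarrow> 'k"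
  proof -
    \<comment> \<open>Whatever the nodes are, these polynomials are monic of degree
      \<open>k\<close>; the rest of the block shows that antisymmetry removes all lower
      coefficients.\<close>
    define p where "p k = (\<Prod>l<k. [:- r l, 1:])" for k
    have p: "degree (p k) = k \<and> lead_coeff (p k) = 1" for k
    proof (induction k)
      case (Suc k)
      have p: "p (Suc k) = p k * [:- r k, 1:]" by (simp add: p_def)
      have "p k \<noteq> 0" using Suc by auto
      then have "degree (p (Suc k)) = Suc (degree (p k))"
        unfolding p by (subst degree_mult_eq) simp_all
      moreover have "lead_coeff (p (Suc k)) = lead_coeff (p k)"
        unfolding p by (subst lead_coeff_mult) simp
      ultimately show ?case using Suc by metis
    qed (simp add: p_def)
    have deg: "degree (p k) = k" "coeff (p k) k = 1" for k using p[of k] by auto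
    have "(\<Prod>l<k. t - r l) = poly (p k) t" for k t
      by (simp add: p_def poly_prod)
    then have ev: "(\<Prod>l<k. t - r l) = (\<Sum>a\<le>k. coeff (p k) a * t ^ a)" for k t
      by (simp add: poly_altdef deg)
    define P where "P = PiE {1..n} (\<lambda>i. {..n - i})"
    define C where "C f = (\<Prod>i\<in>{1..n}. coeff (p (n - i)) (f i))" for f
    have "(\<Sum>u | u permutes {1..n}. of_int (sign u) * (\<Prod>i\<in>{1..n}. \<Prod>l<n - i. y (u i) - r l)) =
        (\<Sum>u | u permutes {1..n}. \<Sum>f\<in>P. of_int (sign u) * (C f * (\<Prod>i\<in>{1..n}. y (u i) ^ f i)))"
      unfolding ev P_def C_def
      by (subst prod_sum_PiE) (auto simp: sum_distrib_left prod.distrib)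
    also have "\<dots> = (\<Sum>f\<in>P. C f * alternant n y f)"
      unfolding alternant_def sum_distrib_left by (subst sum.swap) (simp add: mult.left_commute)
    also have "\<dots> = (\<Sum>f\<in>{restrict (\<lambda>i. n - i) {1..n}}. C f * alternant n y f)"
    proof (rule sum.mono_neutral_right)
      show "finite P" by (auto simp: P_def intro: finite_PiE)
      show "{restrict (\<lambda>i. n - i) {1..n}} \<subseteq> P" by (auto simp: P_def)
      show "\<forall>f\<in>P - {restrict (\<lambda>i. n - i) {1..n}}. C f * alternant n y f = 0"
      proof
        fix f assume f: "f \<in> P - {restrict (\<lambda>i. n - i) {1..n}}"
        have "\<not> inj_on f {1..n}"
        proof
          assume inj: "inj_on f {1..n}"
          have le: "f i \<le> n - i" if "i \<in> {1..n}" for i using f that by (auto simp: P_def PiE_def Pi_def)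
          have "f ` {1..n} \<subseteq> {0..<n}"
          proof
            fix k assume "k \<in> f ` {1..n}"
            then obtain i where "i \<in> {1..n}" "k = f i" by blast
            then show "k \<in> {0..<n}" using le[of i] by auto
          qed
          then have "f ` {1..n} = {0..<n}"
            using inj by (intro card_subset_eq) (auto simp: card_image)
          then have "(\<Sum>i\<in>{1..n}. f i) = (\<Sum>i\<in>{1..n}. n - i)"
            using sum.reindex[OF inj, of "\<lambda>k. k"] sum_staircase[of n] by (simp only: comp_def)
          \<comment> \<open>An injective \<open>f\<close> takes each of 0, ..., n - 1 once, so its
            sum reaches that of the upper bounds \<open>n - i\<close>, and every bound is
            tight.\<close>
          then have "f i = n - i" if "i \<in> {1..n}" for i
            using sum_mono_inv[of f "{1..n}" "\<lambda>i. n - i"] le that by simp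
          then have "f = restrict (\<lambda>i. n - i) {1..n}"
            using f by (auto simp: P_def PiE_def extensional_def fun_eq_iff)
          then show False using f by simp
        qed
        then show "C f * alternant n y f = 0" by (simp add: alternant_eq_0)
      qed
    qed
    also have "\<dots> = alternant n y (\<lambda>i. n - i)"
      by (simp add: C_def deg alternant_def)
    finally show ?thesis .
  qed
  define r' where "r' l = y (n - l)" for l
  have zero: "(\<Prod>i\<in>{1..n}. \<Prod>l<n - i. y (u i) - r' l) = 0" if u: "u permutes {1..n}" "u \<noteq> id" for u
  proof -
    \<comment> \<open>A permutation other than \<open>id\<close> exceeds its argument somewhere, and
      there \<open>y (u i)\<close> is among the first \<open>n - i\<close> nodes, at index
      \<open>n - u i\<close>.\<close>
    obtain i where i: "i \<in> {1..n}" "i < u i"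
      using permutes_natset_le[OF u(1)] u(2) by (meson not_le)
    then have "u i \<le> n" using u(1) permutes_in_image[OF u(1), of i] by auto
    then have "n - u i < n - i" "y (u i) - r' (n - u i) = 0" using i by (auto simp: r'_def)
    then have "(\<Prod>l<n - i. y (u i) - r' l) = 0" by (intro prod_zero) auto
    then show ?thesis using i by (intro prod_zero) auto
  qed
  have "alternant n y (\<lambda>i. n - i) =
      (\<Sum>u | u permutes {1..n}. of_int (sign u) * (\<Prod>i\<in>{1..n}. \<Prod>l<n - i. y (u i) - r' l))"
    using leading[of r'] by simp
  also have "\<dots> = (\<Sum>u\<in>{id}. of_int (sign u) * (\<Prod>i\<in>{1..n}. \<Prod>l<n - i. y (u i) - r' l))"
    using zero by (intro sum.mono_neutral_right) (auto simp: finite_permutations permutes_id)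
  also have "\<dots> = (\<Prod>i\<in>{1..n}. \<Prod>l<n - i. y i - y (n - l))" by (simp add: r'_def)
  also have "\<dots> = (\<Prod>i\<in>{1..n}. \<Prod>j\<in>{i<..n}. y i - y j)"
    by (intro prod.cong refl prod.reindex_bij_witness[of _ "\<lambda>j. n - j" "\<lambda>l. n - l"]) auto
  finally show ?thesis using leading[of r] by simp
qed

text \<open>Coefficient extraction yields a sum over exponent vectors of fixed total. Alternants
  with a repeated exponent vanish, and distinct exponents with this total are a rearrangement of 0,
  ..., n - 1. So the Vandermonde alternant factors out and a determinant in \<open>c\<close>
  remains.\<close>

lemma alternating_prod_nth:
  fixes c :: "nat \<Rightarrow> nat \<Rightarrow> 'k::field_char_0"
  shows "(\<Sum>u | u permutes {1..n}. of_int (sign u) *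
        fps_nth (\<Prod>i\<in>{1..n}. Abs_fps (\<lambda>a. c i a * y (u i) ^ a)) (\<Sum>i\<in>{1..n}. n - i)) =
     (\<Sum>s | s permutes {1..n}. of_int (sign s) * (\<Prod>i\<in>{1..n}. c i (n - s i))) * alternant n y (\<lambda>i. n - i)"
proof -
  let ?N = "\<Sum>i\<in>{1..n}. n - i"
  define \<M> where "\<M> = multisets_of_size {1..n} ?N"
  define C where "C f = (\<Prod>i\<in>{1..n}. c i (f i))" for f
  have fin: "finite \<M>" unfolding \<M>_def by (rule finite_multisets_of_size) simp
  have "(\<Sum>u | u permutes {1..n}. of_int (sign u) *
        fps_nth (\<Prod>i\<in>{1..n}. Abs_fps (\<lambda>a. c i a * y (u i) ^ a)) ?N) =
      (\<Sum>u | u permutes {1..n}. \<Sum>X\<in>\<M>. of_int (sign u) * (C (count X) * (\<Prod>i\<in>{1..n}. y (u i) ^ count X i)))"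
    by (simp add: fps_prod_nth' \<M>_def C_def prod.distrib sum_distrib_left)
  also have "\<dots> = (\<Sum>X\<in>\<M>. C (count X) * alternant n y (count X))"
    unfolding alternant_def sum_distrib_left by (subst sum.swap) (simp add: mult.left_commute)
  also have "\<dots> = (\<Sum>X\<in>{X\<in>\<M>. inj_on (count X) {1..n}}. C (count X) * alternant n y (count X))"
    using fin by (intro sum.mono_neutral_right) (auto simp: alternant_eq_0)
  also have "\<dots> = (\<Sum>s | s permutes {1..n}. C (\<lambda>i. n - s i) * alternant n y (\<lambda>i. n - s i))"
  proof -
    \<comment> \<open>The coefficient formula for products indexes exponent vectors by multisets of
      positions, with multiplicity as exponent; \<open>ms s\<close> encodes the vector
      \<open>n - s i\<close>.\<close>
    define ms where "ms s = (\<Sum>i\<in>{1..n}. replicate_mset (n - s i) i)" for s :: "nat \<Rightarrow> nat"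
    have cnt: "count (ms s) i = (if i \<in> {1..n} then n - s i else 0)" for s i
      by (simp add: ms_def count_sum)
    have bij: "bij_betw ms {s. s permutes {1..n}} {X\<in>\<M>. inj_on (count X) {1..n}}"
    proof (rule bij_betw_imageI)
      show "inj_on ms {s. s permutes {1..n}}"
      proof (rule inj_onI)
        fix s t assume st: "s \<in> {s. s permutes {1..n}}" "t \<in> {s. s permutes {1..n}}" "ms s = ms t"
        have "s i = t i" for i
        proof (cases "i \<in> {1..n}")
          case True
          then have "s i \<le> n" "t i \<le> n" using st permutes_in_image by fastforce+
          moreover have "n - s i = n - t i" using cnt[of s i] cnt[of t i] True st(3) by simp
          ultimately show ?thesis by simp
        next
          case False
          then show ?thesis using st by (metis mem_Collect_eq permutes_not_in)
        qed
        then show "s = t" by blast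
      qed
      show "ms ` {s. s permutes {1..n}} = {X\<in>\<M>. inj_on (count X) {1..n}}"
      proof (intro set_eqI iffI)
        fix X assume "X \<in> ms ` {s. s permutes {1..n}}"
        then obtain s where s: "s permutes {1..n}" and X: "X = ms s" by blast
        have "size X = (\<Sum>i\<in>{1..n}. n - s i)" by (simp add: X ms_def size_multiset_sum)
        also have "\<dots> = ?N" using sum.permute[OF s, of "\<lambda>i. n - i"] by (simp add: comp_def)
        finally have "size X = ?N" .
        moreover have "set_mset X \<subseteq> {1..n}"
          using cnt[of s] by (auto simp: X count_greater_zero_iff[symmetric] split: if_splits simp del: count_greater_zero_iff)
        moreover have "inj_on (count X) {1..n}"
        proof (rule inj_onI)
          fix i j assume ij: "i \<in> {1..n}" "j \<in> {1..n}" "count X i = count X j"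
          then have "s i \<le> n" "s j \<le> n" using s permutes_in_image[OF s] by fastforce+
          then have "s i = s j" using ij by (simp add: X cnt)
          then show "i = j" using permutes_inj[OF s] by (simp add: inj_eq)
        qed
        ultimately show "X \<in> {X\<in>\<M>. inj_on (count X) {1..n}}"
          by (simp add: \<M>_def multisets_of_size_def)
      next
        fix X assume "X \<in> {X\<in>\<M>. inj_on (count X) {1..n}}"
        then have X: "set_mset X \<subseteq> {1..n}" "size X = ?N" "inj_on (count X) {1..n}"
          by (simp_all add: \<M>_def multisets_of_size_def)
        have "(\<Sum>i\<in>{1..n}. count X i) = ?N"
          using X unfolding X(2)[symmetric] size_multiset_overloaded_eq
          by (intro sum.mono_neutral_right) (auto simp: not_in_iff)
        then obtain s where s: "s permutes {1..n}" "\<And>i. i \<in> {1..n} \<Longrightarrow> count X i = n - s i"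
          using inj_staircase_permutation[OF X(3)] by blast
        have "X = ms s"
          using s X(1) by (intro multiset_eqI) (auto simp: cnt not_in_iff[symmetric])
        then show "X \<in> ms ` {s. s permutes {1..n}}" using s by blast
      qed
    qed
    have "C (count (ms s)) * alternant n y (count (ms s)) =
        C (\<lambda>i. n - s i) * alternant n y (\<lambda>i. n - s i)" for s
      by (simp add: C_def alternant_def cnt)
    then show ?thesis
      using sum.reindex_bij_betw[OF bij, of "\<lambda>X. C (count X) * alternant n y (count X)"] by simp
  qed
  also have "\<dots> = (\<Sum>s | s permutes {1..n}. of_int (sign s) * C (\<lambda>i. n - s i)) * alternant n y (\<lambda>i. n - i)"
    unfolding sum_distrib_right
  proof (intro sum.cong refl)
    fix s assume "s \<in> {s. s permutes {1..n}}"
    then have "alternant n y (\<lambda>i. n - s i) = of_int (sign s) * alternant n y (\<lambda>i. n - i)"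
      using alternant_permute[of s n y "\<lambda>i. n - i"] by (simp add: comp_def)
    then show "C (\<lambda>i. n - s i) * alternant n y (\<lambda>i. n - s i) =
        of_int (sign s) * C (\<lambda>i. n - s i) * alternant n y (\<lambda>i. n - i)" by simp
  qed
  finally show ?thesis by (simp add: C_def)
qed


section \<open>The generating function of the iterated raising operator\<close>

context differential_points begin

lemma D_sum: "D (\<Sum>i\<in>I. f i) = (\<Sum>i\<in>I. D (f i))"
  by (induction I rule: infinite_finite_induct) (simp_all add: D_add)

lemma D_of_nat: "D (of_nat k) = 0"
  by (induction k) (simp_all add: D_add)

definition D_fps :: "'k fps \<Rightarrow> 'k fps" where
  "D_fps f = Abs_fps (\<lambda>k. D (fps_nth f k))"

lemma D_fps_mult: "D_fps (f * g) = f * D_fps g + D_fps f * g"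
  by (simp add: fps_eq_iff D_fps_def fps_mult_nth D_sum D_mult sum.distrib)

text \<open>This is z^a times the binomial coefficient of b / z over a, written without dividing by
  \<open>z\<close>. Hence \<open>flow b y\<close> is the expansion of (1 + z t y)^(b / z) in
  t.\<close>

definition flow_coeff :: "'k \<Rightarrow> nat \<Rightarrow> 'k" where
  "flow_coeff b a = (\<Prod>l<a. b - of_nat l * z) / fact a"

definition flow :: "'k \<Rightarrow> 'k \<Rightarrow> 'k fps" where
  "flow b y = Abs_fps (\<lambda>a. flow_coeff b a * y ^ a)"

lemma D_power_x: "D (x i ^ a) = of_nat a * x i ^ Suc a"
  by (induction a) (simp_all add: D_mult D_x algebra_simps)

lemma D_prod_0: "(\<And>i. i \<in> I \<Longrightarrow> D (f i) = 0) \<Longrightarrow> D (\<Prod>i\<in>I. f i) = 0"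
  by (induction I rule: infinite_finite_induct) (simp_all add: D_mult)

lemma D_divide_of_nat: "D (a / of_nat k) = D a / of_nat k"
proof (cases "k = 0")
  case False
  have "D a = D (of_nat k * (a / of_nat k))" using False by simp
  also have "\<dots> = of_nat k * D (a / of_nat k)" by (simp only: D_mult D_of_nat) simp
  finally show ?thesis using False by simp
qed simp

lemma D_flow_coeff:
  assumes "D b = 0"
  shows "D (flow_coeff b a) = 0"
proof -
  have "D (\<Prod>l<a. b - of_nat l * z) = 0"
    using assms by (intro D_prod_0) (simp add: D_diff D_mult D_of_nat D_z)
  moreover have "flow_coeff b a = (\<Prod>l<a. b - of_nat l * z) / of_nat (fact a)"
    by (simp add: flow_coeff_def)
  ultimately show ?thesis by (simp only: D_divide_of_nat) simp
qed

lemma flow_coeff_Suc: "of_nat (Suc a) * flow_coeff b (Suc a) = (b - of_nat a * z) * flow_coeff b a"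
proof -
  have ne: "(of_nat (Suc a) :: 'k) \<noteq> 0" by (rule of_nat_neq_0)
  show ?thesis
    unfolding flow_coeff_def prod.lessThan_Suc fact_Suc times_divide_eq_right
      mult_divide_mult_cancel_left[OF ne]
    by (simp only: mult.commute)
qed

text \<open>The factor \<open>b - of_nat a * z\<close> that links consecutive coefficients splits
  into multiplication by \<open>b\<close> and the action of \<open>D\<close>, since \<open>D\<close>
  sends x^a to a x^(a+1).\<close>

lemma fps_deriv_flow:
  assumes "D b = 0"
  shows "fps_deriv (flow b (x j)) =
    fps_const (b * x j) * flow b (x j) - fps_const z * D_fps (flow b (x j))"
proof (rule fps_ext)
  fix a
  have "fps_nth (fps_deriv (flow b (x j))) a =
      (of_nat (Suc a) * flow_coeff b (Suc a)) * x j ^ Suc a"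
    by (simp add: flow_def)
  also have "\<dots> = (b - of_nat a * z) * flow_coeff b a * x j ^ Suc a"
    unfolding flow_coeff_Suc ..
  finally show "fps_nth (fps_deriv (flow b (x j))) a =
    fps_nth (fps_const (b * x j) * flow b (x j) - fps_const z * D_fps (flow b (x j))) a"
    using assms by (simp add: flow_def D_fps_def D_mult D_flow_coeff D_power_x algebra_simps)
qed

text \<open>Both \<open>fps_deriv\<close> and \<open>D_fps\<close> obey the Leibniz rule, so the
  equations of the factors add up to one whose coefficient is the linear form of
  \<open>raise\<close>.\<close>

lemma fps_deriv_prod_flow:
  assumes "finite I" "\<And>i. i \<in> I \<Longrightarrow> D (\<beta> i) = 0"
  shows "fps_deriv (\<Prod>i\<in>I. flow (\<beta> i) (x (u i))) =
    fps_const (\<Sum>i\<in>I. \<beta> i * x (u i)) * (\<Prod>i\<in>I. flow (\<beta> i) (x (u i))) -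
    fps_const z * D_fps (\<Prod>i\<in>I. flow (\<beta> i) (x (u i)))"
  using assms
proof (induction I rule: finite_induct)
  case empty
  show ?case by (simp add: fps_eq_iff D_fps_def)
next
  case (insert i I)
  define F G where "F = flow (\<beta> i) (x (u i))" and "G = (\<Prod>i\<in>I. flow (\<beta> i) (x (u i)))"
  have F: "fps_deriv F = fps_const (\<beta> i * x (u i)) * F - fps_const z * D_fps F"
    using insert by (simp add: F_def fps_deriv_flow)
  have G: "fps_deriv G = fps_const (\<Sum>i\<in>I. \<beta> i * x (u i)) * G - fps_const z * D_fps G"
    using insert by (simp add: G_def)
  have "fps_deriv (F * G) = fps_const (\<beta> i * x (u i) + (\<Sum>i\<in>I. \<beta> i * x (u i))) * (F * G) -
      fps_const z * D_fps (F * G)"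
    unfolding fps_deriv_mult F G D_fps_mult fps_const_add[symmetric]
    by (simp only: algebra_simps)
  then show ?case
    using insert by (simp add: F_def G_def)
qed

text \<open>By the differential equation one application of \<open>raise\<close> maps the
  coefficient of t^k to k + 1 times the next one; these multipliers accumulate to the
  factorial.\<close>

lemma raises_replicate:
  assumes "const_seq \<beta>"
  shows "raises (replicate k \<beta>) u = fact k * fps_nth (\<Prod>i\<in>{1..n}. flow (\<beta> i) (x (u i))) k"
proof (induction k arbitrary: u)
  case 0
  have "fps_nth (\<Prod>i\<in>I. flow (\<beta> i) (x (u i))) 0 = 1" if "finite I" for I
    using that by (induction I rule: finite_induct) (auto simp: flow_def flow_coeff_def)
  then show ?case by simp
next
  case (Suc k)
  let ?G = "\<Prod>i\<in>{1..n}. flow (\<beta> i) (x (u i))"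
  have "fps_nth (fps_deriv ?G) k =
    (\<Sum>i\<in>{1..n}. \<beta> i * x (u i)) * fps_nth ?G k - z * D (fps_nth ?G k)"
    using assms by (subst fps_deriv_prod_flow) (auto simp: const_seq_def D_fps_def)
  then have G: "of_nat (Suc k) * fps_nth ?G (Suc k) =
    (\<Sum>i\<in>{1..n}. \<beta> i * x (u i)) * fps_nth ?G k - z * D (fps_nth ?G k)"
    by simp
  have "D (fact k * fps_nth ?G k) = fact k * D (fps_nth ?G k)"
    using D_of_nat[of "fact k"] by (simp add: D_mult)
  then have "raises (replicate (Suc k) \<beta>) u =
      fact k * ((\<Sum>i\<in>{1..n}. \<beta> i * x (u i)) * fps_nth ?G k - z * D (fps_nth ?G k))"
    by (simp add: raise_def Suc.IH algebra_simps)
  then show ?case unfolding G[symmetric] by (simp add: algebra_simps)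
qed

theorem chain_sum_w0:
  assumes "const_seq \<beta>"
  shows "chain_sum z n (replicate staircase \<beta>) (w0 n) =
    fact staircase * (\<Prod>i\<in>{1..n}. (\<Prod>j\<in>{i<..n}. \<beta> i - \<beta> j) / fact (n - i))"
proof -
  let ?V = "alternant n x (\<lambda>i. n - i)"
  let ?S = "\<Sum>s | s permutes {1..n}. of_int (sign s) * (\<Prod>i\<in>{1..n}. flow_coeff (\<beta> i) (n - s i))"
  have V: "pairing (monomial (\<lambda>i. n - i)) (\<lambda>u. 1) = ?V"
    by (simp add: pairing_def monomial_def alternant_def)
  have "?V = (\<Prod>i\<in>{1..n}. \<Prod>j\<in>{i<..n}. x i - x j)"
    using newton_alternant[of x "\<lambda>_. 0" n] by (simp add: alternant_def)
  then have V0: "?V \<noteq> 0" using inj_x by (simp add: inj_eq)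
  have "?V * chain_sum z n (replicate staircase \<beta>) (w0 n) =
      pairing (\<lambda>u. 1) (raises (replicate staircase \<beta>))"
    using assms by (subst pairing_raises_w0) (simp_all add: V)
  also have "\<dots> = fact staircase * (\<Sum>u | u permutes {1..n}. of_int (sign u) *
      fps_nth (\<Prod>i\<in>{1..n}. Abs_fps (\<lambda>a. flow_coeff (\<beta> i) a * x (u i) ^ a)) staircase)"
    by (simp add: pairing_def raises_replicate[OF assms] sum_distrib_left flow_def mult.left_commute)
  also have "\<dots> = ?V * (fact staircase * ?S)"
    unfolding alternating_prod_nth[where c = "\<lambda>i. flow_coeff (\<beta> i)" and y = x and n = n]
    by (simp only: ac_simps)
  finally have "chain_sum z n (replicate staircase \<beta>) (w0 n) = fact staircase * ?S"
    using V0 by simp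
  \<comment> \<open>Summing over inverses moves the permutation from the degrees to the \<beta>'s.
    The result is a determinant of Newton polynomials with nodes \<open>of_nat l * z\<close>, to
    which \<open>newton_alternant\<close> applies.\<close>
  also have "?S = (\<Sum>s | s permutes {1..n}. of_int (sign s) * (\<Prod>i\<in>{1..n}. flow_coeff (\<beta> (s i)) (n - i)))"
  proof (subst sum_permutations_inverse, intro sum.cong refl)
    fix s assume "s \<in> {s. s permutes {1..n}}"
    then have s: "s permutes {1..n}" by simp
    then have "sign (inv s) = sign s"
      using permutation_permutes by (intro sign_inverse) blast
    moreover have "(\<Prod>i\<in>{1..n}. flow_coeff (\<beta> i) (n - inv s i)) =
        (\<Prod>i\<in>{1..n}. flow_coeff (\<beta> (s i)) (n - i))"
      using prod.permute[OF s, of "\<lambda>i. flow_coeff (\<beta> i) (n - inv s i)"]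
      by (simp add: comp_def permutes_inverses[OF s])
    ultimately show "of_int (sign (inv s)) * (\<Prod>i\<in>{1..n}. flow_coeff (\<beta> i) (n - inv s i)) =
        of_int (sign s) * (\<Prod>i\<in>{1..n}. flow_coeff (\<beta> (s i)) (n - i))" by simp
  qed
  also have "\<dots> = (\<Prod>i\<in>{1..n}. \<Prod>j\<in>{i<..n}. \<beta> i - \<beta> j) / (\<Prod>i\<in>{1..n}. fact (n - i))"
    unfolding flow_coeff_def prod_dividef times_divide_eq_right sum_divide_distrib[symmetric]
      newton_alternant[of \<beta> "\<lambda>l. of_nat l * z" n] ..
  finally show ?thesis by (simp add: prod_dividef)
qed

end

section \<open>Coxeter length and covers\<close>

definition inversions :: "nat \<Rightarrow> (nat \<Rightarrow> nat) \<Rightarrow> nat" where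
  "inversions n w = card {(i, j). 1 \<le> i \<and> i < j \<and> j \<le> n \<and> w j < w i}"

lemma finite_inversions: "finite {(i, j). 1 \<le> i \<and> i < j \<and> j \<le> n \<and> w j < w i}"
  for w :: "nat \<Rightarrow> nat"
  by (rule finite_subset[of _ "{1..n} \<times> {1..n}"]) auto

lemma inversions_ascent:
  assumes m: "1 \<le> m" "m < n" "w m < w (Suc m)"
  shows "inversions n (w \<circ> sw m) = Suc (inversions n w)"
proof -
  define h where "h = (\<lambda>(i, j). (sw m i, sw m j))"
  let ?I = "\<lambda>w. {(i, j). 1 \<le> i \<and> i < j \<and> j \<le> n \<and> w j < (w i :: nat)}"
  have hh: "h (h p) = p" for p by (cases p) (simp add: h_def)
  have iff: "(sw m i, sw m j) \<in> ?I (w \<circ> sw m) \<longleftrightarrow> (i, j) \<in> ?I w"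
    if "i < j" "(i, j) \<noteq> (m, Suc m)" for i j
    using that m sw_less_sw[OF that] by (auto simp: transpose_def split: if_splits)
  have "?I (w \<circ> sw m) = insert (m, Suc m) (h ` ?I w)"
  proof (intro set_eqI iffI)
    fix p assume p: "p \<in> ?I (w \<circ> sw m)"
    show "p \<in> insert (m, Suc m) (h ` ?I w)"
    proof (cases "p = (m, Suc m)")
      case False
      obtain a b where ab: "p = (a, b)" by fastforce
      have lt: "sw m a < sw m b" "(sw m a, sw m b) \<noteq> (m, Suc m)"
        using p ab False by (auto simp: transpose_def split: if_splits)
      have "(sw m (sw m a), sw m (sw m b)) \<in> ?I (w \<circ> sw m)" using p ab by simp
      then have "h p \<in> ?I w" using iff[OF lt] ab by (simp add: h_def)
      moreover have "p = h (h p)" by (simp only: hh)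
      ultimately show ?thesis by (intro insertI2 image_eqI)
    qed simp
  next
    fix p assume "p \<in> insert (m, Suc m) (h ` ?I w)"
    then show "p \<in> ?I (w \<circ> sw m)"
    proof
      assume "p = (m, Suc m)"
      then show ?thesis using m by simp
    next
      assume "p \<in> h ` ?I w"
      then obtain i j where p: "p = (sw m i, sw m j)" "(i, j) \<in> ?I w" by (auto simp: h_def)
      then have "i < j" "(i, j) \<noteq> (m, Suc m)" using m by auto
      from iff[OF this] p show ?thesis by simp
    qed
  qed
  moreover have "(m, Suc m) \<notin> h ` ?I w"
  proof
    assume "(m, Suc m) \<in> h ` ?I w"
    then obtain p where p: "p \<in> ?I w" "h p = (m, Suc m)" by force
    then have "p = (Suc m, m)" using hh[of p] by (simp add: h_def)
    then show False using p by simp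
  qed
  moreover have "inj_on h (?I w)" by (rule inj_on_inverseI) (rule hh)
  ultimately show ?thesis
    by (simp only: inversions_def card_insert_disjoint finite_imageI finite_inversions card_image
        not_False_eq_True)
qed

lemma inversions_descent:
  assumes m: "1 \<le> m" "m < n" "w (Suc m) < w m"
  shows "inversions n w = Suc (inversions n (w \<circ> sw m))"
  using inversions_ascent[of m n "w \<circ> sw m"] m by (simp add: comp_assoc)

lemma sw_permutes: "1 \<le> m \<Longrightarrow> m < n \<Longrightarrow> sw m permutes {1..n}"
  by (rule permutes_swap_id) auto

lemma permutes_comp_sw:
  "w permutes {1..n} \<Longrightarrow> 1 \<le> m \<Longrightarrow> m < n \<Longrightarrow> w \<circ> sw m permutes {1..n}"
  by (intro permutes_compose[OF sw_permutes])

lemma simple_product_append: "simple_product (js @ [m]) = simple_product js \<circ> sw m"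
  by (induction js) (auto simp: simple_product_def fun_eq_iff)

lemma inversions_id: "inversions n id = 0"
proof -
  have empty: "{(i, j). 1 \<le> i \<and> i < j \<and> j \<le> n \<and> id j < id i} = {}" by auto
  show ?thesis unfolding inversions_def empty by (rule card.empty)
qed

lemma inversions_simple_product:
  assumes "set js \<subseteq> {1..<n}"
  shows "inversions n (simple_product js) \<le> length js"
  using assms
proof (induction js rule: rev_induct)
  case Nil
  then show ?case by (simp add: simple_product_def inversions_id[unfolded id_def] inversions_id)
next
  case (snoc m js)
  let ?u = "simple_product js"
  have m: "1 \<le> m" "m < n" using snoc.prems by auto
  consider "?u m < ?u (Suc m)" | "?u (Suc m) < ?u m" | "?u m = ?u (Suc m)" by linarith
  then have "inversions n (?u \<circ> sw m) \<le> Suc (inversions n ?u)"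
  proof cases
    case 1
    then show ?thesis using inversions_ascent m by simp
  next
    case 2
    then show ?thesis using inversions_descent[OF m 2] by simp
  next
    case 3
    then have "?u \<circ> sw m = ?u" by (auto simp: fun_eq_iff transpose_def)
    then show ?thesis by simp
  qed
  then have "inversions n (?u \<circ> sw m) \<le> length (js @ [m])" using snoc by simp
  then show ?case by (simp only: simple_product_append)
qed

lemma no_descent_imp_id:
  assumes w: "w permutes {1..n}" and "\<And>m. 1 \<le> m \<Longrightarrow> m < n \<Longrightarrow> w m < w (Suc m)"
  shows "w = id"
proof -
  have "i \<le> w i" if "1 \<le> i" "i \<le> n" for i
    using that
  proof (induction i rule: nat_induct_at_least)
    case base
    then have "w 1 \<in> {1..n}" using permutes_in_image[OF w] by simp
    then show ?case by simp
  next
    case (Suc i)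
    then show ?case using assms(2)[of i] by simp
  qed
  then show ?thesis by (intro permutes_natset_ge[OF w]) auto
qed

lemma simple_product_exists:
  assumes "w permutes {1..n}"
  shows "\<exists>js. length js = inversions n w \<and> set js \<subseteq> {1..<n} \<and> w = simple_product js"
  using assms
proof (induction "inversions n w" arbitrary: w rule: less_induct)
  case less
  show ?case
  proof (cases "\<exists>m. 1 \<le> m \<and> m < n \<and> w (Suc m) < w m")
    case True
    then obtain m where m: "1 \<le> m" "m < n" "w (Suc m) < w m" by blast
    note inv = inversions_descent[OF m]
    obtain js where js: "length js = inversions n (w \<circ> sw m)" "set js \<subseteq> {1..<n}"
      "w \<circ> sw m = simple_product js"
      using less.hyps[of "w \<circ> sw m"] inv permutes_comp_sw[OF less.prems m(1,2)] by auto
    have "w = simple_product (js @ [m])"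
      unfolding simple_product_append js(3)[symmetric] by (simp add: comp_assoc)
    then show ?thesis using js inv m by (intro exI[of _ "js @ [m]"]) auto
  next
    case False
    have "w = id"
    proof (rule no_descent_imp_id[OF less.prems])
      fix m assume "1 \<le> m" "m < n"
      moreover have "w m \<noteq> w (Suc m)" using permutes_inj[OF less.prems] by (simp add: inj_eq)
      ultimately show "w m < w (Suc m)" using False by force
    qed
    then show ?thesis by (intro exI[of _ "[]"]) (simp add: simple_product_def inversions_id)
  qed
qed

lemma coxeter_length_eq_inversions:
  assumes "w permutes {1..n}"
  shows "coxeter_length n w = inversions n w"
  unfolding coxeter_length_def
proof (rule Least_equality)
  show "\<exists>js. length js = inversions n w \<and> set js \<subseteq> {1..<n} \<and> w = simple_product js"
    using simple_product_exists[OF assms] .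
qed (use inversions_simple_product in blast)

text \<open>Exchanging \<open>a\<close> and \<open>Suc b\<close> is exchanging \<open>a\<close> and
  \<open>b\<close> conjugated by \<open>sw b\<close>. The two outer simple exchanges change the
  length by one each; the changes add up to two when \<open>w b\<close> lies between
  \<open>w (Suc b)\<close> and \<open>w a\<close>, and cancel otherwise.\<close>

lemma inversions_transpose:
  assumes "a < b" "inj w" "1 \<le> a" "b \<le> n" "w b < w a"
  shows "inversions n w = inversions n (w \<circ> transpose a b) + 1 +
    2 * card {k. a < k \<and> k < b \<and> w b < w k \<and> w k < w a}"
  using assms
proof (induction b arbitrary: w)
  case (Suc b)
  show ?case
  proof (cases "a = b")
    case True
    then have empty: "{k. a < k \<and> k < Suc b \<and> w (Suc b) < w k \<and> w k < w a} = {}" by auto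
    have "inversions n w = Suc (inversions n (w \<circ> sw b))"
      using Suc.prems True by (intro inversions_descent) auto
    then show ?thesis
      unfolding empty by (simp only: True card.empty mult_0_right add_0_right Suc_eq_plus1)
  next
    case False
    then have ab: "a < b" using Suc.prems by simp
    have b: "1 \<le> b" "b < n" using ab Suc.prems by auto
    define v where "v = w \<circ> sw b"
    have v: "v a = w a" "v b = w (Suc b)" "v (Suc b) = w b"
      using ab by (simp_all add: v_def)
    have inj: "inj v" unfolding v_def using Suc.prems by (intro inj_compose) auto
    have IH: "inversions n v = inversions n (v \<circ> transpose a b) + 1 +
        2 * card {k. a < k \<and> k < b \<and> v b < v k \<and> v k < v a}"
      using Suc.prems v inj ab by (intro Suc.IH) auto
    have S: "{k. a < k \<and> k < b \<and> v b < v k \<and> v k < v a} =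
        {k. a < k \<and> k < b \<and> w (Suc b) < w k \<and> w k < w a}" (is "_ = ?S")
      unfolding v by (auto simp: v_def transpose_def split: if_splits)
    have wt: "w \<circ> transpose a (Suc b) = v \<circ> transpose a b \<circ> sw b"
      using ab by (auto simp: v_def fun_eq_iff transpose_def)
    have vt: "(v \<circ> transpose a b) b = w a" "(v \<circ> transpose a b) (Suc b) = w b"
      using ab v by simp_all
    have fin: "finite ?S" by simp
    have between: "{k. a < k \<and> k < Suc b \<and> w (Suc b) < w k \<and> w k < w a} =
        (if w (Suc b) < w b \<and> w b < w a then insert b ?S else ?S)"
      using ab by (auto simp: less_Suc_eq)
    have neq: "w b \<noteq> w (Suc b)" "w b \<noteq> w a" using Suc.prems ab by (auto simp: inj_eq)
    then consider "w (Suc b) < w b" "w b < w a" | "w b < w (Suc b)" "w b < w a" |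
      "w (Suc b) < w b" "w a < w b"
      using Suc.prems by linarith
    then show ?thesis
    proof cases
      case 1
      then have "inversions n w = Suc (inversions n v)"
        unfolding v_def using inversions_descent[OF b] by simp
      moreover have "inversions n (v \<circ> transpose a b) = Suc (inversions n (w \<circ> transpose a (Suc b)))"
        unfolding wt using inversions_descent[OF b, of "v \<circ> transpose a b"] 1 unfolding vt by simp
      moreover have "card {k. a < k \<and> k < Suc b \<and> w (Suc b) < w k \<and> w k < w a} = Suc (card ?S)"
        unfolding between using 1 fin by simp
      ultimately show ?thesis using IH unfolding S by linarith
    next
      case 2
      then have "inversions n v = Suc (inversions n w)"
        unfolding v_def using inversions_ascent[OF b] by simp
      moreover have "inversions n (v \<circ> transpose a b) = Suc (inversions n (w \<circ> transpose a (Suc b)))"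
        unfolding wt using inversions_descent[OF b, of "v \<circ> transpose a b"] 2 unfolding vt by simp
      moreover have "card {k. a < k \<and> k < Suc b \<and> w (Suc b) < w k \<and> w k < w a} = card ?S"
        unfolding between using 2 by simp
      ultimately show ?thesis using IH unfolding S by linarith
    next
      case 3
      then have "inversions n w = Suc (inversions n v)"
        unfolding v_def using inversions_descent[OF b] by simp
      moreover have "inversions n (w \<circ> transpose a (Suc b)) = Suc (inversions n (v \<circ> transpose a b))"
        unfolding wt using inversions_ascent[OF b, of "v \<circ> transpose a b"] 3 unfolding vt by simp
      moreover have "card {k. a < k \<and> k < Suc b \<and> w (Suc b) < w k \<and> w k < w a} = card ?S"
        unfolding between using 3 by simp
      ultimately show ?thesis using IH unfolding S by linarith
    qed
  qed
qed simp

lemma down_pairs_iff_inversions: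
  assumes w: "inj w" and ab: "1 \<le> a" "a < b" "b \<le> n"
  shows "(a, b) \<in> down_pairs n w \<longleftrightarrow> inversions n w = Suc (inversions n (w \<circ> transpose a b))"
proof -
  have ne: "w i = w j \<longleftrightarrow> i = j" for i j using w by (simp add: inj_eq)
  show ?thesis
  proof (cases "w b < w a")
    case True
    have fin: "finite {k. a < k \<and> k < b \<and> w b < w k \<and> w k < w a}" by simp
    have "(w b < w k \<and> w k < w a) \<longleftrightarrow> \<not> (w k < w b \<or> w a < w k)" if "a < k" "k < b" for k
    proof -
      have "w k \<noteq> w a" "w k \<noteq> w b" using ne that by auto
      then show ?thesis by arith
    qed
    then have "card {k. a < k \<and> k < b \<and> w b < w k \<and> w k < w a} = 0 \<longleftrightarrow>
        (\<forall>k. a < k \<longrightarrow> k < b \<longrightarrow> w k < w b \<or> w a < w k)"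
      unfolding card_0_eq[OF fin] by blast
    then show ?thesis
      using inversions_transpose[OF ab(2) w ab(1,3) True] True ab by (simp add: down_pairs_def)
  next
    case False
    then have "w a < w b" using ne[of a b] ab by linarith
    moreover have "inj (w \<circ> transpose a b)" using w by (intro inj_compose) auto
    ultimately have "inversions n w < inversions n (w \<circ> transpose a b)"
      using inversions_transpose[OF ab(2) _ ab(1,3), of "w \<circ> transpose a b"] by (simp add: comp_assoc)
    then show ?thesis using False by (simp add: down_pairs_def)
  qed
qed

lemma bruhat_cover_iff:
  assumes w: "w permutes {1..n}"
  shows "bruhat_cover n v w \<longleftrightarrow> (\<exists>(a, b)\<in>down_pairs n w. v = w \<circ> transpose a b)"
proof
  assume "bruhat_cover n v w"
  then obtain a b where v: "v permutes {1..n}" and ab: "1 \<le> a" "a < b" "b \<le> n"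
    and wv: "w = v \<circ> transpose a b" and len: "coxeter_length n w = coxeter_length n v + 1"
    by (auto simp: bruhat_cover_def)
  have vw: "v = w \<circ> transpose a b" by (simp add: wv comp_assoc)
  have "(a, b) \<in> down_pairs n w"
    using len v w ab vw by (subst down_pairs_iff_inversions) (auto simp: coxeter_length_eq_inversions permutes_inj)
  then show "\<exists>(a, b)\<in>down_pairs n w. v = w \<circ> transpose a b" using vw by blast
next
  assume "\<exists>(a, b)\<in>down_pairs n w. v = w \<circ> transpose a b"
  then obtain a b where ab: "(a, b) \<in> down_pairs n w" and vw: "v = w \<circ> transpose a b" by blast
  have b: "1 \<le> a" "a < b" "b \<le> n" using ab by (auto simp: down_pairs_def)
  have v: "v permutes {1..n}" unfolding vw using b
    by (intro permutes_compose[OF permutes_swap_id w]) auto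
  have "inversions n w = Suc (inversions n v)"
    using ab down_pairs_iff_inversions[OF permutes_inj[OF w] b] by (simp add: vw)
  moreover have "w = v \<circ> transpose a b" by (simp add: vw comp_assoc)
  ultimately show "bruhat_cover n v w"
    using v w b by (auto simp: bruhat_cover_def coxeter_length_eq_inversions)
qed

section \<open>Chains and polynomials\<close>

lemma inj_transpose_comp:
  fixes w :: "nat \<Rightarrow> nat"
  assumes "inj w" "a < b" "a' < b'" "w \<circ> transpose a b = w \<circ> transpose a' b'"
  shows "(a, b) = (a', b')"
proof -
  have swap: "swap_positions (w \<circ> transpose i j) w = (i, j)" if "i < j" for i j
  proof -
    have "inj (w \<circ> transpose i j)" using \<open>inj w\<close> by (intro inj_compose) auto
    then show ?thesis using swap_positions_eq[OF _ that] by (fastforce simp: comp_assoc)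
  qed
  show ?thesis using swap[OF assms(2)] swap[OF assms(3)] unfolding assms(4) by (rule trans[OF sym])
qed

lemma down_pairs_permutes:
  assumes "w permutes {1..n}" "(a, b) \<in> down_pairs n w"
  shows "w \<circ> transpose a b permutes {1..n}"
  using assms by (intro permutes_compose[OF permutes_swap_id]) (auto simp: down_pairs_def)

lemma down_pairs_inversions:
  assumes "w permutes {1..n}" "(a, b) \<in> down_pairs n w"
  shows "inversions n w = Suc (inversions n (w \<circ> transpose a b))"
  using assms down_pairs_iff_inversions[of w a b n]
  by (auto simp: down_pairs_def permutes_inj)

lemma saturated_chains_snoc:
  assumes w: "w permutes {1..n}" and v: "v permutes {1..n}"
  shows "saturated_chains n v w = (if v = w then {[w]} else {}) \<union>
    (\<Union>(a, b)\<in>down_pairs n w. (\<lambda>c. c @ [w]) ` saturated_chains n v (w \<circ> transpose a b))"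
    (is "?L = ?R")
proof (intro set_eqI iffI)
  fix c assume c: "c \<in> ?L"
  then have "c \<noteq> []" "last c = w" by (auto simp: saturated_chains_def)
  then obtain c' where cc: "c = c' @ [w]" by (metis append_butlast_last_id)
  show "c \<in> ?R"
  proof (cases "c' = []")
    case True
    then show ?thesis using c cc by (auto simp: saturated_chains_def)
  next
    case False
    have "bruhat_cover n (last c') w" and c': "c' \<in> saturated_chains n v (last c')"
      using c cc False by (auto simp: saturated_chains_def successively_append_iff)
    then obtain a b where "(a, b) \<in> down_pairs n w" "last c' = w \<circ> transpose a b"
      using bruhat_cover_iff[OF w] by blast
    then show ?thesis using c' cc by fastforce
  qed
next
  fix c assume "c \<in> ?R"
  then consider "v = w" "c = [w]" | a b c' where "(a, b) \<in> down_pairs n w" "c = c' @ [w]"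
    "c' \<in> saturated_chains n v (w \<circ> transpose a b)"
    by (auto split: if_splits)
  then show "c \<in> ?L"
  proof cases
    case 1
    then show ?thesis using w by (auto simp: saturated_chains_def)
  next
    case 2
    then have "bruhat_cover n (w \<circ> transpose a b) w" using bruhat_cover_iff[OF w] by blast
    then show ?thesis using 2 w by (auto simp: saturated_chains_def successively_append_iff)
  qed
qed

lemma chain_weight_snoc:
  assumes "c \<noteq> []"
  shows "chain_weight wt (c @ [w]) = chain_weight wt c * wt (last c) w"
proof -
  obtain k where k: "length c = Suc k" using assms by (cases c) auto
  have "chain_weight wt (c @ [w]) = (\<Prod>i<Suc k. wt ((c @ [w]) ! i) ((c @ [w]) ! Suc i))"
    by (simp add: chain_weight_def k)
  also have "\<dots> = (\<Prod>i<k. wt (c ! i) (c ! Suc i)) * wt (c ! k) w"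
    using k by (simp add: nth_append)
  finally show ?thesis using k assms by (simp add: chain_weight_def last_conv_nth)
qed

lemma finite_saturated_chains:
  assumes "w permutes {1..n}" "v permutes {1..n}"
  shows "finite (saturated_chains n v w)"
  using assms
proof (induction "inversions n w" arbitrary: w rule: less_induct)
  case less
  have "finite (saturated_chains n v (w \<circ> transpose a b))" if "(a, b) \<in> down_pairs n w" for a b
    using less down_pairs_permutes[OF less.prems(1) that] down_pairs_inversions[OF less.prems(1) that]
    by simp
  then show ?case
    unfolding saturated_chains_snoc[OF less.prems] by auto
qed

lemma weighted_chain_sum_rec:
  assumes w: "w permutes {1..n}" and v: "v permutes {1..n}"
  shows "weighted_chain_sum n wt v w = of_bool (v = w) +
    (\<Sum>(a, b)\<in>down_pairs n w. weighted_chain_sum n wt v (w \<circ> transpose a b) * wt (w \<circ> transpose a b) w)"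
proof -
  define B where "B = (\<lambda>(a, b). (\<lambda>c. c @ [w]) ` saturated_chains n v (w \<circ> transpose a b))"
  have fin: "finite (B p)" if "p \<in> down_pairs n w" for p
    using that finite_saturated_chains[OF down_pairs_permutes[OF w] v] by (cases p) (auto simp: B_def)
  \<comment> \<open>The penultimate element of a chain recovers the pair that produced it, which
    makes the sets \<open>B p\<close> disjoint; having one at all excludes the one-element
    chain.\<close>
  have last: "last (butlast c) = w \<circ> transpose a b" "butlast c \<noteq> []" if "c \<in> B (a, b)" for a b c
    using that by (auto simp: B_def saturated_chains_def)
  have "B p \<inter> B q = {}" if "p \<in> down_pairs n w" "q \<in> down_pairs n w" "p \<noteq> q" for p q
  proof (rule ccontr)
    obtain a b a' b' where pq: "p = (a, b)" "q = (a', b')" by fastforce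
    assume "B p \<inter> B q \<noteq> {}"
    then obtain c where "c \<in> B (a, b)" "c \<in> B (a', b')" using pq by blast
    then have "w \<circ> transpose a b = w \<circ> transpose a' b'" using last(1) by metis
    moreover have "a < b" "a' < b'" using that pq by (auto simp: down_pairs_def)
    ultimately show False using inj_transpose_comp[OF permutes_inj[OF w]] that(3) pq by blast
  qed
  then have "sum (chain_weight wt) (\<Union>p\<in>down_pairs n w. B p) =
      (\<Sum>p\<in>down_pairs n w. sum (chain_weight wt) (B p))"
    using fin by (intro sum.UNION_disjoint) auto
  also have "\<dots> = (\<Sum>(a, b)\<in>down_pairs n w.
      weighted_chain_sum n wt v (w \<circ> transpose a b) * wt (w \<circ> transpose a b) w)"
  proof (intro sum.cong refl, clarify)
    fix a b
    have "inj_on (\<lambda>c. c @ [w]) S" for S by (simp add: inj_on_def)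
    then have "sum (chain_weight wt) (B (a, b)) =
        (\<Sum>c\<in>saturated_chains n v (w \<circ> transpose a b). chain_weight wt (c @ [w]))"
      by (simp add: B_def sum.reindex)
    also have "\<dots> = (\<Sum>c\<in>saturated_chains n v (w \<circ> transpose a b).
        chain_weight wt c * wt (w \<circ> transpose a b) w)"
      by (intro sum.cong refl) (auto simp: chain_weight_snoc saturated_chains_def)
    finally show "sum (chain_weight wt) (B (a, b)) =
        weighted_chain_sum n wt v (w \<circ> transpose a b) * wt (w \<circ> transpose a b) w"
      by (simp add: weighted_chain_sum_def sum_distrib_right)
  qed
  finally have B: "sum (chain_weight wt) (\<Union>p\<in>down_pairs n w. B p) =
      (\<Sum>(a, b)\<in>down_pairs n w. weighted_chain_sum n wt v (w \<circ> transpose a b) * wt (w \<circ> transpose a b) w)" .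
  have "[w] \<notin> B p" for p
  proof
    assume "[w] \<in> B p"
    then have "butlast [w] \<noteq> []" using last(2) by (cases p) blast
    then show False by simp
  qed
  then have disj: "(if v = w then {[w]} else {}) \<inter> (\<Union>p\<in>down_pairs n w. B p) = {}"
    by simp
  have "saturated_chains n v w = (if v = w then {[w]} else {}) \<union> (\<Union>p\<in>down_pairs n w. B p)"
    unfolding saturated_chains_snoc[OF w v] by (simp add: B_def case_prod_unfold)
  then have "weighted_chain_sum n wt v w = sum (chain_weight wt) (if v = w then {[w]} else {}) +
      sum (chain_weight wt) (\<Union>p\<in>down_pairs n w. B p)"
    unfolding weighted_chain_sum_def using fin disj by (simp only: sum.union_disjoint) (simp add: sum.union_disjoint)
  then show ?thesis unfolding B by (simp add: chain_weight_def)
qed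

lemma bruhat_weight_down:
  assumes w: "w permutes {1..n}" and ab: "(a, b) \<in> down_pairs n w"
  shows "bruhat_weight (w \<circ> transpose a b) w =
    (\<Sum>k\<in>{a..<b}. alpha_var k) + Const (excess w a b) * z_var"
proof -
  have lt: "a < b" using ab by (simp add: down_pairs_def)
  have "excess w a b = (\<Sum>k\<in>{a<..<b}. of_bool (w a < w k)) - (\<Sum>k\<in>{a<..<b}. of_bool (w k < w b))"
    by (simp add: excess_def sum_subtractf)
  also have "(\<Sum>k\<in>{a<..<b}. of_bool (w a < w k)) = int (card {k. a < k \<and> k < b \<and> w a < w k})"
    by (simp add: of_bool_def sum.If_cases Int_def)
  also have "(\<Sum>k\<in>{a<..<b}. of_bool (w k < w b)) = int (card {k. a < k \<and> k < b \<and> w k < w b})"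
    by (simp add: of_bool_def sum.If_cases Int_def)
  finally have ex: "excess w a b = int (card {k. a < k \<and> k < b \<and> w a < w k}) -
      int (card {k. a < k \<and> k < b \<and> w k < w b})" .
  let ?v = "w \<circ> transpose a b"
  have "w = ?v \<circ> transpose a b" by (simp add: comp_assoc)
  then have "bruhat_weight ?v w = (\<Sum>k\<in>{a..<b}. alpha_var k) +
    Const (int (card {k. a < k \<and> k < b \<and> ?v k > ?v b}) -
           int (card {k. a < k \<and> k < b \<and> ?v k < ?v a})) * z_var"
    using bruhat_weight_eq[OF down_pairs_permutes[OF w ab] lt] by simp
  also have "{k. a < k \<and> k < b \<and> ?v k > ?v b} = {k. a < k \<and> k < b \<and> w a < w k}"
    by (auto simp: transpose_def)
  also have "{k. a < k \<and> k < b \<and> ?v k < ?v a} = {k. a < k \<and> k < b \<and> w k < w b}"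
    by (auto simp: transpose_def)
  finally show ?thesis by (simp only: ex)
qed

text \<open>A weighted sum over saturated chains has no step counter, while \<open>chain_sum\<close>
  consumes one sequence per cover. They agree for a list of length \<open>inversions n w\<close>
  because every cover lowers this number by one. The homomorphism carries polynomial weights into
  the differential field.\<close>

lemma chain_sum_eq_weighted_chain_sum:
  fixes \<phi> :: "'r::comm_ring_1 \<Rightarrow> 'k::comm_ring_1"
  assumes add: "\<And>a b. \<phi> (a + b) = \<phi> a + \<phi> b" and mult: "\<And>a b. \<phi> (a * b) = \<phi> a * \<phi> b"
    and one: "\<phi> 1 = 1"
    and wt: "\<And>w a b. w permutes {1..n} \<Longrightarrow> (a, b) \<in> down_pairs n w \<Longrightarrow>
      \<phi> (wt (w \<circ> transpose a b) w) = pair_weight z \<beta> w a b"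
    and w: "w permutes {1..n}"
  shows "\<phi> (weighted_chain_sum n wt id w) = chain_sum z n (replicate (inversions n w) \<beta>) w"
  using w
proof (induction "inversions n w" arbitrary: w)
  have "\<phi> 0 = 0" using add[of 0 0] by simp
  then have sum: "\<phi> (\<Sum>i\<in>I. f i) = (\<Sum>i\<in>I. \<phi> (f i))" for I :: "(nat \<times> nat) set" and f
    by (induction I rule: infinite_finite_induct) (simp_all add: add)
  have rec: "\<phi> (weighted_chain_sum n wt id w) = of_bool (id = w) +
    (\<Sum>(a, b)\<in>down_pairs n w. \<phi> (weighted_chain_sum n wt id (w \<circ> transpose a b)) * pair_weight z \<beta> w a b)"
    if "w permutes {1..n}" for w
  proof -
    have "\<phi> (of_bool (id = w)) = of_bool (id = w)" using one \<open>\<phi> 0 = 0\<close> by simp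
    then show ?thesis
      unfolding weighted_chain_sum_rec[OF that permutes_id] add sum
      by (simp add: case_prod_unfold mult wt[OF that] cong: sum.cong)
  qed
  {
    case 0
    have "down_pairs n w = {}" using down_pairs_inversions[OF 0(2)] 0(1) by fastforce
    moreover have "inversions n w = 0" using 0(1) by simp
    ultimately have "\<phi> (weighted_chain_sum n wt id w) = chain_sum z n (replicate (inversions n w) \<beta>) w"
      using rec[OF 0(2)] by (simp only: replicate.simps chain_sum.simps sum.empty add_0_right eq_commute[of id w])
    then show ?case .
  next
    case (Suc k)
    have "w \<noteq> id" using Suc.hyps(2) inversions_id[of n] by auto
    have "\<phi> (weighted_chain_sum n wt id (w \<circ> transpose a b)) =
        chain_sum z n (replicate k \<beta>) (w \<circ> transpose a b)" if "(a, b) \<in> down_pairs n w" for a b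
      using Suc.hyps down_pairs_inversions[OF Suc.prems that] down_pairs_permutes[OF Suc.prems that]
      by simp
    then have "(\<Sum>(a, b)\<in>down_pairs n w. \<phi> (weighted_chain_sum n wt id (w \<circ> transpose a b)) * pair_weight z \<beta> w a b) =
       (\<Sum>(a, b)\<in>down_pairs n w. pair_weight z \<beta> w a b * chain_sum z n (replicate k \<beta>) (w \<circ> transpose a b))"
      by (intro sum.cong refl) (auto simp: mult.commute)
    then have "\<phi> (weighted_chain_sum n wt id w) = chain_sum z n (replicate (Suc k) \<beta>) w"
      using rec[OF Suc.prems] \<open>w \<noteq> id\<close> by simp
    then show ?case unfolding Suc.hyps(2) .
  }
qed

lemma inversions_w0: "inversions n (w0 n) = (\<Sum>i\<in>{1..n}. n - i)"
proof -
  have "{(i, j). 1 \<le> i \<and> i < j \<and> j \<le> n \<and> w0 n j < w0 n i} = Sigma {1..n} (\<lambda>i. {i<..n})"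
    by (auto simp: w0_def)
  then show ?thesis by (simp add: inversions_def)
qed

text \<open>\<open>differential_points\<close> needs a field of characteristic zero; this fraction
  field supplies the coefficients of the Laurent series used for it.\<close>

instance fract :: ("{idom, ring_char_0}") field_char_0
proof
  have "(of_nat k :: 'a fract) = to_fract (of_nat k)" for k
    by (induction k) simp_all
  then show "inj (of_nat :: nat \<Rightarrow> 'a fract)"
    by (simp add: inj_def)
qed

section \<open>Integer polynomials among the rational ones, and which indeterminates occur\<close>

lemma lookup_rat_mpolynomial:
  "Poly_Mapping.lookup (rat_mpolynomial p) m = rat_of_int (Poly_Mapping.lookup p m)"
  by (simp add: rat_mpolynomial_def Poly_Mapping.map.rep_eq when_def)

lemma of_int_Sum_any: "rat_of_int (Sum_any f) = Sum_any (\<lambda>a. rat_of_int (f a))"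
  by (simp add: Sum_any.expand_set)

lemma rat_mpolynomial_add: "rat_mpolynomial (p + q) = rat_mpolynomial p + rat_mpolynomial q"
  by (rule poly_mapping_eqI) (simp add: lookup_rat_mpolynomial lookup_add)

lemma rat_mpolynomial_mult: "rat_mpolynomial (p * q) = rat_mpolynomial p * rat_mpolynomial q"
proof (rule poly_mapping_eqI)
  fix m
  have "rat_of_int (a when P) = (rat_of_int a when P)" for a P by (simp add: when_def)
  then show "Poly_Mapping.lookup (rat_mpolynomial (p * q)) m =
      Poly_Mapping.lookup (rat_mpolynomial p * rat_mpolynomial q) m"
    by (simp add: lookup_rat_mpolynomial lookup_mult of_int_Sum_any)
qed

lemma rat_mpolynomial_Const: "rat_mpolynomial (Const c) = Const (rat_of_int c)"
  unfolding Const_def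
  by (rule poly_mapping_eqI) (simp only: lookup_rat_mpolynomial lookup_single when_def, simp)

lemma rat_mpolynomial_Var: "rat_mpolynomial (Var i) = Var i"
  by (rule poly_mapping_eqI) (simp add: lookup_rat_mpolynomial Var_def lookup_single when_def)

lemma rat_mpolynomial_sum: "rat_mpolynomial (\<Sum>i\<in>I. f i) = (\<Sum>i\<in>I. rat_mpolynomial (f i))"
  by (rule poly_mapping_eqI) (simp add: lookup_rat_mpolynomial lookup_sum)

lemma Const_1: "Const 1 = 1"
  by (simp add: Const_def)

lemma Const_mult: "Const (a * b) = Const a * Const b"
  by (simp add: Const_def mult_single)

lemma Const_of_nat: "Const (of_nat k) = of_nat k"
  by (simp add: Const_def)

lemma not_occurs_in_mult:
  assumes "\<not> occurs_in x p" "\<not> occurs_in x q"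
  shows "\<not> occurs_in x (p * q)"
  using assms keys_mult[of p q] by (force simp: occurs_in_def lookup_add)

lemma not_occurs_in_sum:
  assumes "\<And>i. i \<in> I \<Longrightarrow> \<not> occurs_in x (f i)"
  shows "\<not> occurs_in x (\<Sum>i\<in>I. f i)"
  using assms keys_sum[of f I] by (fastforce simp: occurs_in_def)

lemma not_occurs_in_prod:
  assumes "\<And>i. i \<in> I \<Longrightarrow> \<not> occurs_in x (f i)"
  shows "\<not> occurs_in x (\<Prod>i\<in>I. f i)"
  using assms
proof (induction I rule: infinite_finite_induct)
  case (insert i I)
  then show ?case by (simp add: not_occurs_in_mult)
qed (simp_all add: occurs_in_def)

lemma not_occurs_in_Const: "\<not> occurs_in x (Const c)"
  by (simp add: occurs_in_def Const_def)

lemma occurs_in_Var: "occurs_in x (Var i :: 'a::comm_ring_1 mpolynomial) \<Longrightarrow> x = i"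
  by (auto simp: occurs_in_def Var_def lookup_single when_def split: if_splits)

lemma occurs_in_rat_mpolynomial: "occurs_in x (rat_mpolynomial p) \<longleftrightarrow> occurs_in x p"
  by (simp add: occurs_in_def in_keys_iff Bex_def lookup_rat_mpolynomial)


text \<open>Polynomials become constant Laurent series, so the derivation kills all \<alpha>'s and
  z. The map is injective, which lets the final identity be pulled back.\<close>

definition embed :: "rat mpolynomial \<Rightarrow> rat mpolynomial fract fls" where
  "embed p = fls_const (to_fract p)"

lemma embed_add: "embed (p + q) = embed p + embed q"
  by (simp add: embed_def fls_plus_const)

lemma embed_mult: "embed (p * q) = embed p * embed q"
  by (simp add: embed_def)

lemma embed_0: "embed 0 = 0"
  by (simp add: embed_def)

lemma embed_1: "embed 1 = 1"
  by (simp add: embed_def)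

lemma embed_eq_iff: "embed p = embed q \<longleftrightarrow> p = q"
  by (metis embed_def fls_const_nth to_fract_eq_iff)

lemma embed_sum: "embed (\<Sum>i\<in>I. f i) = (\<Sum>i\<in>I. embed (f i))"
  by (induction I rule: infinite_finite_induct) (simp_all add: embed_0 embed_add)

lemma embed_prod: "embed (\<Prod>i\<in>I. f i) = (\<Prod>i\<in>I. embed (f i))"
  by (induction I rule: infinite_finite_induct) (simp_all add: embed_1 embed_mult)

lemma embed_of_nat: "embed (of_nat k) = of_nat k"
  by (induction k) (simp_all add: embed_0 embed_1 embed_add)

lemma embed_of_int: "embed (of_int k) = of_int k"
proof (cases k)
  case (nonneg m)
  then show ?thesis by (simp add: embed_of_nat)
next
  case (neg m)
  have "embed (of_int k) + embed (of_nat (Suc m)) = embed (of_int k + of_nat (Suc m))"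
    by (simp only: embed_add)
  also have "\<dots> = of_int k + of_nat (Suc m)"
    using neg by (simp add: embed_0)
  finally show ?thesis by (simp add: embed_of_nat del: of_nat_Suc)
qed

lemma prod_greaterThan_diff:
  "(\<Prod>j\<in>{i<..n}. of_nat (j - i)) = (fact (n - i) :: 'a::{comm_semiring_1, semiring_char_0})"
proof -
  have "(\<Prod>j\<in>{i<..n}. of_nat (j - i)) = (\<Prod>k\<in>{1..n - i}. of_nat k :: 'a)"
    by (rule prod.reindex_bij_witness[of _ "\<lambda>k. k + i" "\<lambda>j. j - i"]) auto
  then show ?thesis by (simp add: fact_prod)
qed

lemma sum_diff_nat_eq_choose: "(\<Sum>i\<in>{1..n}. n - i) = n choose 2"
proof (cases n)
  case (Suc m)
  have "(\<Sum>i\<in>{1..n}. n - i) = \<Sum>{0..m}"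
    unfolding sum_staircase Suc atLeastLessThanSuc_atLeastAtMost ..
  then show ?thesis
    using gauss_sum_nat[of m] by (simp add: choose_two Suc mult.commute)
qed simp

theorem theorem1p3:
  fixes n :: nat
  assumes "n \<ge> 1"
  shows "rat_mpolynomial (weighted_chain_sum n bruhat_weight id (w0 n)) =
           Const (of_nat (fact (n choose 2))) *
           (\<Prod>(k, l)\<in>{(k, l). 1 \<le> k \<and> k < l \<and> l \<le> n}.
              Const (1 / of_nat (l - k)) * (\<Sum>i\<in>{k..<l}. alpha_var i))
         \<and> \<not> occurs_in z_index (weighted_chain_sum n bruhat_weight id (w0 n))"
proof -
  define x :: "nat \<Rightarrow> rat mpolynomial fract fls" where "x i = inverse (of_nat i - fls_X)" for i
  define z where "z = embed z_var"
  \<comment> \<open>Tail sums turn the sum of the \<alpha>'s from \<open>a\<close> to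
    \<open>b - 1\<close> into \<open>\<beta> a - \<beta> b\<close>, the shape produced by a linear
    form with one coefficient per variable.\<close>
  define \<beta> where "\<beta> i = (\<Sum>k\<in>{i..<n}. embed (alpha_var k))" for i
  interpret differential_points fls_deriv x z n
  proof
    show "fls_deriv (x i) = x i * x i" for i
      by (simp add: x_def fls_inverse_deriv power2_eq_square)
    show "inj x"
      by (rule injI) (simp add: x_def)
    show "fls_deriv z = 0"
      by (simp add: z_def embed_def)
  qed (simp_all add: add.commute)
  let ?W = "weighted_chain_sum n bruhat_weight id (w0 n)"
  let ?P = "Const (of_nat (fact (n choose 2))) *
           (\<Prod>(k, l)\<in>{(k, l). 1 \<le> k \<and> k < l \<and> l \<le> n}.
              Const (1 / of_nat (l - k)) * (\<Sum>i\<in>{k..<l}. alpha_var i)) :: rat mpolynomial"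
  have \<beta>: "\<beta> a - \<beta> b = (\<Sum>k\<in>{a..<b}. embed (alpha_var k))" if "a < b" "b \<le> n" for a b
    using sum.atLeastLessThan_concat[of a b n "\<lambda>k. embed (alpha_var k)"] that
    by (simp add: \<beta>_def algebra_simps)
  have const: "const_seq \<beta>"
    by (simp add: const_seq_def \<beta>_def fls_deriv_sum embed_def)
  have "embed (rat_mpolynomial ?W) = chain_sum z n (replicate (inversions n (w0 n)) \<beta>) (w0 n)"
  proof (rule chain_sum_eq_weighted_chain_sum[where \<phi> = "\<lambda>p. embed (rat_mpolynomial p)"])
    show "embed (rat_mpolynomial 1) = 1"
      using rat_mpolynomial_Const[of 1] by (simp add: Const_1 embed_1)
    show "embed (rat_mpolynomial (bruhat_weight (w \<circ> transpose a b) w)) = pair_weight z \<beta> w a b"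
      if "w permutes {1..n}" "(a, b) \<in> down_pairs n w" for w a b
    proof -
      have "a < b" "b \<le> n" using that by (auto simp: down_pairs_def)
      moreover have "Const (rat_of_int (excess w a b)) = of_int (excess w a b)"
        by (simp add: Const_def)
      ultimately show ?thesis
        unfolding bruhat_weight_down[OF that]
        by (simp add: rat_mpolynomial_add rat_mpolynomial_mult rat_mpolynomial_sum
            rat_mpolynomial_Const rat_mpolynomial_Var embed_add embed_mult embed_sum embed_of_int
            pair_weight_def \<beta> z_def)
    qed
  qed (use w0_permutes in \<open>simp_all add: rat_mpolynomial_add rat_mpolynomial_mult embed_add embed_mult\<close>)
  also have "\<dots> = fact staircase * (\<Prod>i\<in>{1..n}. (\<Prod>j\<in>{i<..n}. \<beta> i - \<beta> j) / fact (n - i))"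
    unfolding inversions_w0 by (rule chain_sum_w0[OF const])
  also have "\<dots> = embed ?P"
  proof -
    have inv: "embed (Const (1 / of_nat m)) = 1 / of_nat m" if "m > 0" for m
    proof -
      have "embed (Const (1 / of_nat m)) * of_nat m = embed (Const (1 / of_nat m) * Const (of_nat m))"
        by (simp add: embed_mult Const_of_nat embed_of_nat)
      also have "\<dots> = 1" using that by (simp add: Const_mult[symmetric] Const_1 embed_1)
      finally show ?thesis using that by (simp add: field_simps)
    qed
    have set: "{(k, l). 1 \<le> k \<and> k < l \<and> l \<le> n} = Sigma {1..n} (\<lambda>k. {k<..n})" by auto
    have factor: "embed (Const (of_nat (fact (n choose 2)))) = fact staircase"
      unfolding Const_of_nat embed_of_nat sum_diff_nat_eq_choose by (rule of_nat_fact)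
    have "embed ?P = fact staircase * (\<Prod>(k, l)\<in>Sigma {1..n} (\<lambda>k. {k<..n}).
        embed (Const (1 / of_nat (l - k))) * (\<Sum>i\<in>{k..<l}. embed (alpha_var i)))"
      unfolding set
      by (simp only: embed_mult embed_prod embed_sum case_prod_unfold factor)
    also have "(\<Prod>(k, l)\<in>Sigma {1..n} (\<lambda>k. {k<..n}).
        embed (Const (1 / of_nat (l - k))) * (\<Sum>i\<in>{k..<l}. embed (alpha_var i))) =
        (\<Prod>k\<in>{1..n}. \<Prod>l\<in>{k<..n}. (\<beta> k - \<beta> l) / of_nat (l - k))"
      by (subst prod.Sigma[symmetric]) (auto simp: inv \<beta> simp del: of_nat_diff intro!: prod.cong)
    also have "\<dots> = (\<Prod>k\<in>{1..n}. (\<Prod>l\<in>{k<..n}. \<beta> k - \<beta> l) / fact (n - k))"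
      by (simp add: prod_dividef prod_greaterThan_diff del: of_nat_diff)
    finally show ?thesis by simp
  qed
  finally have eq: "rat_mpolynomial ?W = ?P"
    by (simp only: embed_eq_iff)
  \<comment> \<open>The \<alpha>'s in the product have index at least 1 while z has index 0. Passing
    from integer to rational coefficients preserves which indeterminates occur, so independence of z
    transfers to the chain sum.\<close>
  moreover have "\<not> occurs_in z_index ?P"
  proof -
    have "\<not> occurs_in z_index (Const c * (\<Sum>i\<in>{k..<l}. alpha_var i))"
      if "1 \<le> k" for c :: rat and k l
      using that occurs_in_Var
      by (intro not_occurs_in_mult not_occurs_in_Const not_occurs_in_sum) fastforce
    then show ?thesis
      by (intro not_occurs_in_mult not_occurs_in_prod not_occurs_in_Const)
        (auto simp del: of_nat_diff)
  qed
  ultimately show ?thesis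
    using occurs_in_rat_mpolynomial[of z_index ?W] by simp
qed

end
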